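(* Let $0<\epsilon,\delta<1$, $F=1-\epsilon$, and let $\Omega$ be a positive-definite verification operator for $|\Psi\rangle$ with eigenvalues $1=\lambda_1>\lambda_2\ge\dots\ge\lambda_D>0$, second largest eigenvalue $\beta=\lambda_2$ and smallest eigenvalue $\tau=\lambda_D$, where $0<\tau\le\beta<1$. Let $h=[\min\{\beta\ln\beta^{-1},\tau\ln\tau^{-1}\}]^{-1}$, let $\tilde\beta=\beta$ if $\beta\ln\beta^{-1}\le\tau\ln\tau^{-1}$ and $\tilde\beta=\tau$ otherwise, and for $0<x<1$ let $k_-(x)=\lfloor(\ln\delta)/\ln x\rfloor$. Then for $j=2,3,\dots,D$, $$N(\epsilon,\delta,\Omega)\ge N(\epsilon,\delta,\lambda_j)\ge k_-(\lambda_j)+\Big\lceil\frac{k_-(\lambda_j)F}{\lambda_j\epsilon}\Big\rceil;$$ moreover $$k_-(\tilde\beta)+\Big\lceil\frac{k_-(\tilde\beta)F}{\tilde\beta\epsilon}\Big\rceil\le N(\epsilon,\delta,\Omega)\le\Big\lceil\frac{hF\ln(F\delta)^{-1}}{\epsilon}+\frac{\ln(F\delta)}{\ln\beta}-1\Big\rceil<\frac{h\ln(F\delta)^{-1}}{\epsilon},$$ $$N(\epsilon,\delta,\Omega)\le\Big\lceil\frac{hF\ln(\tau\delta)^{-1}}{\epsilon}+\frac{\ln(\tau\delta)}{\ln\beta}-1\Big\rceil<\frac{h\ln(\tau\delta)^{-1}}{\epsilon}.$$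
   Context: Let $\mathcal H$ be a Hilbert space of finite dimension $D\ge2$ and $|\Psi\rangle\in\mathcal H$ a unit vector. A verification operator for $|\Psi\rangle$ is a Hermitian operator $\Omega$ on $\mathcal H$ with $0\le\Omega\le1$, $\Omega|\Psi\rangle=|\Psi\rangle$, whose eigenvalue $1$ is nondegenerate. For an integer $N\ge1$ and a density operator $\rho$ on $\mathcal H^{\otimes(N+1)}$ put $p_\rho=\mathrm{tr}[(\Omega^{\otimes N}\otimes 1)\rho]$ and $f_\rho=\mathrm{tr}[(\Omega^{\otimes N}\otimes|\Psi\rangle\langle\Psi|)\rho]$, $F(N,\delta,\Omega)=\min\{f_\rho/p_\rho:p_\rho\ge\delta\}$ for $0<\delta\le1$ (minimum over permutation-invariant density operators on $\mathcal H^{\otimes(N+1)}$), and for $0<\epsilon,\delta<1$, $N(\epsilon,\delta,\Omega)=\min\{N\ge1:F(N,\delta,\Omega)\ge1-\epsilon\}$. For $0\le\lambda<1$, $N(\epsilon,\delta,\lambda)$ denotes $N(\epsilon,\delta,\Omega_\lambda)$ for the homogeneous operator $\Omega_\lambda=|\Psi\rangle\langle\Psi|+\lambda(1-|\Psi\rangle\langle\Psi|)$. *)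

theory Defs
  imports "HOL-Analysis.Analysis" "Jordan_Normal_Form.Char_Poly"
begin

text \<open>The Hilbert space is C^D; vectors are complex vecs of dimension D, operators are
  complex D x D matrices. The space H^(tensor n) is C^(D^n), where the basis index
  i < D^n corresponds to the tuple of its base-D digits; digit k is tensor factor k.\<close>

definition dig :: "nat \<Rightarrow> nat \<Rightarrow> nat \<Rightarrow> nat" where
  "dig D k i = (i div D ^ k) mod D"

text \<open>(Omega tensor N) tensor P on H^(tensor (N+1)); the last factor (index N) carries P.\<close>
definition tensor_obs :: "nat \<Rightarrow> nat \<Rightarrow> complex mat \<Rightarrow> complex mat \<Rightarrow> complex mat" where
  "tensor_obs D N Om P = mat (D ^ (N + 1)) (D ^ (N + 1))
     (\<lambda>(i, j). (\<Prod>k<N. Om $$ (dig D k i, dig D k j)) * P $$ (dig D N i, dig D N j))"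

definition perm_index :: "nat \<Rightarrow> nat \<Rightarrow> (nat \<Rightarrow> nat) \<Rightarrow> nat \<Rightarrow> nat" where
  "perm_index D n \<sigma> i = (\<Sum>k<n. dig D (\<sigma> k) i * D ^ k)"

text \<open>rho is invariant under all permutations of the n tensor factors: P_sigma rho P_sigma^* = rho.\<close>
definition perm_invariant :: "nat \<Rightarrow> nat \<Rightarrow> complex mat \<Rightarrow> bool" where
  "perm_invariant D n \<rho> \<longleftrightarrow> (\<forall>\<sigma>. \<sigma> permutes {..<n} \<longrightarrow>
     (\<forall>i < D ^ n. \<forall>j < D ^ n. \<rho> $$ (perm_index D n \<sigma> i, perm_index D n \<sigma> j) = \<rho> $$ (i, j)))"

definition hermitian_mat :: "nat \<Rightarrow> complex mat \<Rightarrow> bool" where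
  "hermitian_mat n A \<longleftrightarrow> A \<in> carrier_mat n n \<and> (\<forall>i<n. \<forall>j<n. A $$ (i, j) = cnj (A $$ (j, i)))"

definition qform :: "nat \<Rightarrow> complex mat \<Rightarrow> complex vec \<Rightarrow> complex" where
  "qform n A v = (\<Sum>i<n. \<Sum>j<n. cnj (v $ i) * A $$ (i, j) * v $ j)"

definition psd :: "nat \<Rightarrow> complex mat \<Rightarrow> bool" where
  "psd n A \<longleftrightarrow> hermitian_mat n A \<and> (\<forall>v \<in> carrier_vec n. 0 \<le> Re (qform n A v))"

definition pd :: "nat \<Rightarrow> complex mat \<Rightarrow> bool" where
  "pd n A \<longleftrightarrow> hermitian_mat n A \<and> (\<forall>v \<in> carrier_vec n. v \<noteq> 0\<^sub>v n \<longrightarrow> 0 < Re (qform n A v))"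

definition mtrace :: "nat \<Rightarrow> complex mat \<Rightarrow> complex" where
  "mtrace n A = (\<Sum>i<n. A $$ (i, i))"

definition density_op :: "nat \<Rightarrow> complex mat \<Rightarrow> bool" where
  "density_op n \<rho> \<longleftrightarrow> psd n \<rho> \<and> mtrace n \<rho> = 1"

definition unit_vector :: "nat \<Rightarrow> complex vec \<Rightarrow> bool" where
  "unit_vector D \<Psi> \<longleftrightarrow> \<Psi> \<in> carrier_vec D \<and> (\<Sum>i<D. (cmod (\<Psi> $ i))\<^sup>2) = 1"

definition proj :: "nat \<Rightarrow> complex vec \<Rightarrow> complex mat" where
  "proj D \<Psi> = mat D D (\<lambda>(i, j). \<Psi> $ i * cnj (\<Psi> $ j))"

definition verification_op :: "nat \<Rightarrow> complex vec \<Rightarrow> complex mat \<Rightarrow> bool" where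
  "verification_op D \<Psi> Om \<longleftrightarrow> unit_vector D \<Psi> \<and> psd D Om \<and> psd D (1\<^sub>m D - Om) \<and>
     Om *\<^sub>v \<Psi> = \<Psi> \<and> (\<forall>v \<in> carrier_vec D. Om *\<^sub>v v = v \<longrightarrow> (\<exists>c. v = c \<cdot>\<^sub>v \<Psi>))"

definition pacc :: "nat \<Rightarrow> nat \<Rightarrow> complex mat \<Rightarrow> complex mat \<Rightarrow> real" where
  "pacc D N Om \<rho> = Re (mtrace (D ^ (N + 1)) (tensor_obs D N Om (1\<^sub>m D) * \<rho>))"

definition facc :: "nat \<Rightarrow> complex vec \<Rightarrow> nat \<Rightarrow> complex mat \<Rightarrow> complex mat \<Rightarrow> real" where
  "facc D \<Psi> N Om \<rho> = Re (mtrace (D ^ (N + 1)) (tensor_obs D N Om (proj D \<Psi>) * \<rho>))"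

definition Fmin :: "nat \<Rightarrow> complex vec \<Rightarrow> nat \<Rightarrow> real \<Rightarrow> complex mat \<Rightarrow> real" where
  "Fmin D \<Psi> N \<delta> Om = Inf {facc D \<Psi> N Om \<rho> / pacc D N Om \<rho> | \<rho>.
      density_op (D ^ (N + 1)) \<rho> \<and> perm_invariant D (N + 1) \<rho> \<and> pacc D N Om \<rho> \<ge> \<delta>}"

definition Nver :: "nat \<Rightarrow> complex vec \<Rightarrow> real \<Rightarrow> real \<Rightarrow> complex mat \<Rightarrow> nat" where
  "Nver D \<Psi> \<epsilon> \<delta> Om = (LEAST N. N \<ge> 1 \<and> Fmin D \<Psi> N \<delta> Om \<ge> 1 - \<epsilon>)"

definition hom_op :: "nat \<Rightarrow> complex vec \<Rightarrow> real \<Rightarrow> complex mat" where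
  "hom_op D \<Psi> l = proj D \<Psi> + complex_of_real l \<cdot>\<^sub>m (1\<^sub>m D - proj D \<Psi>)"

definition kminus :: "real \<Rightarrow> real \<Rightarrow> int" where
  "kminus \<delta> x = \<lfloor>ln \<delta> / ln x\<rfloor>"

end

theory Submission
  imports Defs "Jordan_Normal_Form.Schur_Decomposition"
begin

text \<open>
  Measured in a product eigenbasis of \<open>\<Omega>\<close>, a permutation-invariant state is just a
  permutation-invariant probability distribution on words of length \<open>N + 1\<close> over the spectrum, and
  both \<open>p\<close> and \<open>f\<close> depend on it only. By symmetry the untested system may be averaged over all
  positions.

  Upper bounds: let \<open>w\<close> be the product of all \<open>N + 1\<close> eigenvalues of a word and \<open>t = - ln w\<close>. Concavity of
  \<open>x ln (1/x)\<close> gives \<open>1/\<lambda> \<le> h ln (1/\<lambda>)\<close> on \<open>[\<tau>, \<beta>]\<close>, so with \<open>M = h F / \<epsilon> + 1 / ln (1/\<beta>)\<close> the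
  contribution of a word to \<open>(N + 1) (f - F p)\<close> is at least \<open>\<epsilon> w (N + 1 - M t)\<close>. If
  \<open>N + 1 \<ge> M ln (1/y)\<close>, the tangent inequality \<open>w (ln w - ln y) \<ge> w - y\<close> bounds this below by
  \<open>\<epsilon> M (w - y)\<close>. The mean of \<open>w\<close> is at least \<open>\<tau> p\<close> and at least \<open>f\<close>, which handles \<open>y = \<tau> \<delta>\<close> and
  \<open>y = F \<delta>\<close>.

  Lower bounds: replacing all eigenstates orthogonal to the target by the \<open>j\<close>-th one reduces \<open>\<Omega>\<close> to the
  homogeneous operator with eigenvalue \<open>\<lambda> = \<lambda>\<^sub>j\<close>. There, with \<open>k = k\<^sub>-(\<lambda>)\<close> and \<open>n = N - k\<close>, mixing words
  with \<open>k\<close> and \<open>k + 1\<close> bad letters in proportion \<open>\<lambda> n : k\<close> gives \<open>p = \<lambda>\<^sup>k \<ge> \<delta>\<close> and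
  \<open>f / p = \<lambda> n / (\<lambda> n + k)\<close>.
\<close>

unbundle no vec_syntax

section \<open>The spectral theorem for Hermitian matrices\<close>

definition ctrans :: "complex mat \<Rightarrow> complex mat" where
  "ctrans A = mat (dim_col A) (dim_row A) (\<lambda>(i, j). cnj (A $$ (j, i)))"

lemma ctrans_carrier [simp]: "A \<in> carrier_mat n m \<Longrightarrow> ctrans A \<in> carrier_mat m n"
  by (auto simp: ctrans_def)

lemma ctrans_index [simp]:
  "A \<in> carrier_mat n m \<Longrightarrow> i < m \<Longrightarrow> j < n \<Longrightarrow> ctrans A $$ (i, j) = cnj (A $$ (j, i))"
  by (auto simp: ctrans_def)

lemma mat_mult_index_sum:
  assumes "A \<in> carrier_mat n m" "B \<in> carrier_mat m l" "i < n" "j < l"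
  shows "(A * B) $$ (i, j) = (\<Sum>k<m. A $$ (i, k) * B $$ (k, j))"
  using assms by (auto simp: scalar_prod_def lessThan_atLeast0 intro!: sum.cong)

lemma ctrans_mult:
  assumes "A \<in> carrier_mat n m" "B \<in> carrier_mat m l"
  shows "ctrans (A * B) = ctrans B * ctrans A"
proof (rule eq_matI)
  fix i j assume ij: "i < dim_row (ctrans B * ctrans A)" "j < dim_col (ctrans B * ctrans A)"
  have ij': "i < l" "j < n" using ij assms by (auto simp: ctrans_def)
  have AB: "A * B \<in> carrier_mat n l" using assms by auto
  show "ctrans (A * B) $$ (i, j) = (ctrans B * ctrans A) $$ (i, j)"
    using assms ij' AB
    by (simp add: ctrans_index[OF AB] mat_mult_index_sum[OF assms]
        mat_mult_index_sum[OF ctrans_carrier[OF assms(2)] ctrans_carrier[OF assms(1)]]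
        mult.commute del: index_mult_mat)
qed (use assms in \<open>auto simp: ctrans_def\<close>)

lemma ctrans_ctrans [simp]: "ctrans (ctrans A) = A"
  by (rule eq_matI) (auto simp: ctrans_def)

lemma hermitian_mat_iff_ctrans:
  "hermitian_mat n A \<longleftrightarrow> A \<in> carrier_mat n n \<and> ctrans A = A"
proof
  assume h: "hermitian_mat n A"
  then have A: "A \<in> carrier_mat n n" by (simp add: hermitian_mat_def)
  moreover have "ctrans A = A"
  proof (rule eq_matI)
    fix i j assume "i < dim_row A" "j < dim_col A"
    then have ij: "i < n" "j < n" using A by auto
    show "ctrans A $$ (i, j) = A $$ (i, j)"
      unfolding ctrans_index[OF A ij] using h ij unfolding hermitian_mat_def by metis
  qed (use A in \<open>auto simp: ctrans_def\<close>)
  ultimately show "A \<in> carrier_mat n n \<and> ctrans A = A" ..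
next
  assume A: "A \<in> carrier_mat n n \<and> ctrans A = A"
  then have "A $$ (i, j) = cnj (A $$ (j, i))" if "i < n" "j < n" for i j
    using ctrans_index[OF _ that, of A] by metis
  with A show "hermitian_mat n A" unfolding hermitian_mat_def by blast
qed

lemma ctrans_four_block_diag:
  assumes "A \<in> carrier_mat n n" "B \<in> carrier_mat m m"
  shows "ctrans (four_block_mat A (0\<^sub>m n m) (0\<^sub>m m n) B)
    = four_block_mat (ctrans A) (0\<^sub>m n m) (0\<^sub>m m n) (ctrans B)"
  using assms by (intro eq_matI) (auto simp: ctrans_def)

text \<open>Complete \<open>v\<close> to a basis and apply Gram-Schmidt. This keeps the first vector
  but yields orthogonality only, so the columns are normalised afterwards; hence the scalar
  \<open>c\<close>.\<close>

lemma unitary_completion: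
  fixes v :: "complex vec"
  assumes v: "v \<in> carrier_vec n" and v0: "v \<noteq> 0\<^sub>v n"
  shows "\<exists>W c. W \<in> carrier_mat n n \<and> ctrans W * W = 1\<^sub>m n \<and> col W 0 = c \<cdot>\<^sub>v v"
proof -
  interpret cof_vec_space n "TYPE(complex)" .
  define b where "b = basis_completion v"
  from basis_completion[OF v v0, folded b_def]
  have dist_b: "distinct b" and indep: "\<not> lin_dep (set b)" and b: "set b \<subseteq> carrier_vec n"
    and hdb: "hd b = v" and len_b: "length b = n" by auto
  have n: "n \<noteq> 0"
  proof
    assume "n = 0"
    then have "v = 0\<^sub>v n" using v by (intro eq_vecI) auto
    with v0 show False by simp
  qed
  from hdb len_b n obtain vs where bv: "b = v # vs" by (cases b, auto)
  define ws where "ws = gram_schmidt n b"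
  from gram_schmidt_result[OF b dist_b indep refl, folded ws_def]
  have ws: "set ws \<subseteq> carrier_vec n" "corthogonal ws" "length ws = n" by (auto simp: len_b)
  from gram_schmidt_hd[OF v, of vs, folded bv] have hdws: "hd ws = v" unfolding ws_def .
  have ws0: "ws ! 0 = v" using hdws ws(3) n by (cases ws) auto
  have wsc: "dim_vec (ws ! i) = n" if "i < n" for i
    using ws that by (metis carrier_vecD nth_mem subsetD)
  define ip where "ip i j = (\<Sum>k<n. cnj (ws ! i $ k) * ws ! j $ k)" for i j
  \<comment> \<open>Being an equivalence, this also says that no vector of the list has norm zero,
    as the normalisation requires.\<close>
  have ip0: "ip i j = 0 \<longleftrightarrow> i \<noteq> j" if "i < n" "j < n" for i j
  proof -
    have "ip i j = scalar_prod (ws ! j) (conjugate (ws ! i))"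
      using that wsc by (auto simp: ip_def scalar_prod_def lessThan_atLeast0 intro!: sum.cong)
    then show ?thesis using corthogonalD[OF ws(2), of j i] that ws(3) by auto
  qed
  define r where "r i = (\<Sum>k<n. (cmod (ws ! i $ k))\<^sup>2)" for i
  have ipr: "ip i i = of_real (r i)" for i
    by (simp add: ip_def r_def mult.commute flip: complex_norm_square)
  have rpos: "r i > 0" if "i < n" for i
  proof -
    have "r i \<noteq> 0" using ip0[OF that that] ipr[of i] by auto
    moreover have "r i \<ge> 0" unfolding r_def by (intro sum_nonneg) auto
    ultimately show ?thesis by auto
  qed
  define W where "W = mat n n (\<lambda>(k, i). ws ! i $ k / of_real (sqrt (r i)))"
  have W: "W \<in> carrier_mat n n" by (simp add: W_def)
  have "ctrans W * W = 1\<^sub>m n"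
  proof (rule eq_matI)
    fix i j assume "i < dim_row (1\<^sub>m n :: complex mat)" "j < dim_col (1\<^sub>m n :: complex mat)"
    then have ij: "i < n" "j < n" by auto
    have "(ctrans W * W) $$ (i, j) = (\<Sum>k<n. cnj (W $$ (k, i)) * W $$ (k, j))"
      using mat_mult_index_sum[OF ctrans_carrier[OF W] W ij] W ij by simp
    also have "\<dots> = (\<Sum>k<n. cnj (ws ! i $ k) * ws ! j $ k / (of_real (sqrt (r i)) * of_real (sqrt (r j))))"
      using ij by (intro sum.cong) (auto simp: W_def)
    also have "\<dots> = ip i j / (of_real (sqrt (r i)) * of_real (sqrt (r j)))"
      by (simp add: ip_def sum_divide_distrib)
    also have "\<dots> = (if i = j then 1 else 0)"
    proof (cases "i = j")
      case True
      have "complex_of_real (sqrt (r j)) * of_real (sqrt (r j)) = of_real (r j)"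
        using rpos[OF ij(2)] by (simp flip: of_real_mult)
      then show ?thesis using True ipr[of j] rpos[OF ij(2)] by simp
    next
      case False
      then show ?thesis using ip0[OF ij] by simp
    qed
    finally show "(ctrans W * W) $$ (i, j) = 1\<^sub>m n $$ (i, j)" using ij by simp
  qed (use W in \<open>auto simp: ctrans_def\<close>)
  moreover have "col W 0 = (1 / of_real (sqrt (r 0))) \<cdot>\<^sub>v v"
    using n v by (intro eq_vecI) (auto simp: W_def ws0)
  ultimately show ?thesis using W by blast
qed

text \<open>Deflation: in a unitary basis starting with an eigenvector for \<open>e\<close>, the
  first column of the matrix is \<open>e\<close> times the first unit vector. Hermiticity then
  clears the first row too, and the remaining block is Hermitian with one linear factor fewer. The
  diagonal keeps the order of \<open>es\<close>, so that positions can be matched with eigenvalues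
  later.\<close>

theorem hermitian_unitary_diagonalization:
  assumes "hermitian_mat n A" "char_poly A = (\<Prod>e\<leftarrow>es. [:- e, 1:])"
  shows "length es = n \<and> (\<exists>P. similar_mat_wit A
    (mat n n (\<lambda>(i, j). if i = j then es ! i else 0)) P (ctrans P))"
  using assms
proof (induct es arbitrary: n A)
  case Nil
  then have A: "A \<in> carrier_mat n n" by (simp add: hermitian_mat_def)
  have n: "n = 0" using degree_monic_char_poly[OF A] Nil(2) by simp
  have "similar_mat_wit A (mat n n (\<lambda>(i, j). if i = j then [] ! i else 0)) (1\<^sub>m 0) (ctrans (1\<^sub>m 0))"
    using A n by (intro similar_mat_witI[of _ _ 0]) (auto intro!: eq_matI simp: ctrans_def)
  then show ?case using n by auto
next
  case (Cons e es)
  have A: "A \<in> carrier_mat n n" and hA: "ctrans A = A"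
    using Cons(2) by (auto simp: hermitian_mat_iff_ctrans)
  have cp: "char_poly A = [:- e, 1:] * (\<Prod>e\<leftarrow>es. [:- e, 1:])" using Cons(3) by simp
  have mon: "monic (\<Prod>e\<leftarrow>es. [:- e, 1:])" by (rule monic_prod_list, auto)
  have "degree (char_poly A) = Suc (degree (\<Prod>e\<leftarrow>es. [:- e, 1:]))" unfolding cp
    by (subst degree_mult_eq, insert mon, auto)
  with degree_monic_char_poly[OF A] have "n \<noteq> 0" by auto
  then obtain m where n: "n = 1 + m" by (metis add.commute plus_1_eq_Suc not0_implies_Suc)
  have "eigenvalue A e" unfolding eigenvalue_root_char_poly[OF A] cp by simp
  then obtain v where "eigenvector A v e" unfolding eigenvalue_def by auto
  then have v: "v \<in> carrier_vec n" "v \<noteq> 0\<^sub>v n" and Av: "A *\<^sub>v v = e \<cdot>\<^sub>v v"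
    using A by (auto simp: eigenvector_def)
  from unitary_completion[OF v] obtain W c where W: "W \<in> carrier_mat n n"
    and W1: "ctrans W * W = 1\<^sub>m n" and col0: "col W 0 = c \<cdot>\<^sub>v v" by blast
  have cW: "ctrans W \<in> carrier_mat n n" using W by simp
  have W2: "W * ctrans W = 1\<^sub>m n" by (rule mat_mult_left_right_inverse[OF cW W W1])
  define A' where "A' = ctrans W * A * W"
  have A': "A' \<in> carrier_mat n n"
    unfolding A'_def using W A cW by (intro mult_carrier_mat[of _ n n])
  have wit': "similar_mat_wit A' A (ctrans W) W"
    by (rule similar_mat_witI[OF W1 W2 A'_def A' A cW W])
  have wit: "similar_mat_wit A A' W (ctrans W)" by (rule similar_mat_wit_sym[OF wit'])
  have hA': "ctrans A' = A'"
  proof -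
    have c: "ctrans W * A \<in> carrier_mat n n" using cW A by simp
    show ?thesis
      unfolding A'_def ctrans_mult[OF c W] ctrans_mult[OF cW A] hA ctrans_ctrans
      using assoc_mult_mat[OF cW A W] by simp
  qed
  have "col A' 0 = (ctrans W * A) *\<^sub>v col W 0"
    unfolding A'_def using W n by (intro col_mult2[OF mult_carrier_mat[OF cW A]]) auto
  also have "\<dots> = ctrans W *\<^sub>v (A *\<^sub>v col W 0)"
    using W A cW col0 v by (intro assoc_mult_mat_vec[of _ n n _ n]) auto
  also have "A *\<^sub>v col W 0 = e \<cdot>\<^sub>v col W 0"
    using col0 Av v A by (simp add: mult_mat_vec smult_smult_assoc mult.commute)
  also have "ctrans W *\<^sub>v (e \<cdot>\<^sub>v col W 0) = e \<cdot>\<^sub>v (ctrans W *\<^sub>v col W 0)"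
    using cW W by (intro mult_mat_vec[of _ n n]) auto
  also have "ctrans W *\<^sub>v col W 0 = col (1\<^sub>m n) 0"
    unfolding W1[symmetric] using W cW n by (intro col_mult2[symmetric, of _ n n _ n]) auto
  finally have colA': "col A' 0 = e \<cdot>\<^sub>v col (1\<^sub>m n) 0" .
  have A'i0: "A' $$ (i, 0) = (if i = 0 then e else 0)" if "i < n" for i
  proof -
    have "A' $$ (i, 0) = col A' 0 $ i" using A' that n by simp
    also have "\<dots> = (if i = 0 then e else 0)" unfolding colA' using that n by auto
    finally show ?thesis .
  qed
  have A'0i: "A' $$ (0, i) = 0" if "i < n" "i \<noteq> 0" for i
    using ctrans_index[OF A', of 0 i] hA' A'i0[of i] that by auto
  define A3 where "A3 = mat m m (\<lambda>(i, j). A' $$ (Suc i, Suc j))"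
  have A3: "A3 \<in> carrier_mat m m" by (simp add: A3_def)
  define A1 where "A1 = mat 1 1 (\<lambda>_. e)"
  have A1: "A1 \<in> carrier_mat 1 1" by (simp add: A1_def)
  have block: "A' = four_block_mat A1 (0\<^sub>m 1 m) (0\<^sub>m m 1) A3"
    using A' A'i0 A'0i by (intro eq_matI) (auto simp: A1_def A3_def n)
  have "ctrans A3 = A3"
  proof (rule eq_matI)
    fix i j assume "i < dim_row A3" "j < dim_col A3"
    then have ij: "i < m" "j < m" by (auto simp: A3_def)
    have "A' $$ (Suc i, Suc j) = cnj (A' $$ (Suc j, Suc i))"
      using ctrans_index[OF A', of "Suc i" "Suc j"] hA' ij n by simp
    then show "ctrans A3 $$ (i, j) = A3 $$ (i, j)" using ctrans_index[OF A3 ij] ij by (simp add: A3_def)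
  qed (auto simp: ctrans_def A3_def)
  then have hA3: "hermitian_mat m A3" using A3 by (simp add: hermitian_mat_iff_ctrans)
  have "similar_mat A A'" using wit unfolding similar_mat_def by blast
  from char_poly_similar[OF this] cp
  have "[:- e, 1:] * (\<Prod>e\<leftarrow>es. [:- e, 1:]) = char_poly A'" by simp
  also have "\<dots> = char_poly A1 * char_poly A3"
    unfolding block by (rule char_poly_four_block_zeros_col[OF A1 _ A3]) auto
  also have "char_poly A1 = [:- e, 1:]"
    by (simp add: A1_def char_poly_defs det_def sign_def)
  finally have "char_poly A3 = (\<Prod>e\<leftarrow>es. [:- e, 1:])"
    by (metis mult_cancel_left pCons_eq_0_iff zero_neq_one)
  from Cons(1)[OF hA3 this] obtain P where len: "length es = m"
    and P: "similar_mat_wit A3 (mat m m (\<lambda>(i, j). if i = j then es ! i else 0)) P (ctrans P)"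
    by blast
  let ?B = "mat m m (\<lambda>(i, j). if i = j then es ! i else 0)"
  have Pc: "P \<in> carrier_mat m m" using similar_mat_witD2[OF A3 P] by auto
  let ?P = "four_block_mat (1\<^sub>m 1) (0\<^sub>m 1 m) (0\<^sub>m m 1) P"
  have cP: "ctrans ?P = four_block_mat (1\<^sub>m 1) (0\<^sub>m 1 m) (0\<^sub>m m 1) (ctrans P)"
  proof -
    have "ctrans (1\<^sub>m 1) = 1\<^sub>m 1" by (rule eq_matI) (auto simp: ctrans_def)
    then show ?thesis using ctrans_four_block_diag[of "1\<^sub>m 1" 1 P m] Pc by simp
  qed
  have "similar_mat_wit A' (four_block_mat A1 (0\<^sub>m 1 m) (0\<^sub>m m 1) ?B) ?P (ctrans ?P)"
    unfolding block cP
    using Pc left_mult_zero_mat[OF ctrans_carrier[OF Pc], of 1]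
    by (intro similar_mat_wit_four_block[OF similar_mat_wit_refl[OF A1] P _ _ A1 A3]) auto
  from similar_mat_wit_trans[OF wit this]
  have "similar_mat_wit A (four_block_mat A1 (0\<^sub>m 1 m) (0\<^sub>m m 1) ?B) (W * ?P) (ctrans ?P * ctrans W)" .
  moreover have "ctrans ?P * ctrans W = ctrans (W * ?P)"
    using W Pc n by (intro ctrans_mult[symmetric, of _ n n _ n]) auto
  moreover have "four_block_mat A1 (0\<^sub>m 1 m) (0\<^sub>m m 1) ?B
      = mat n n (\<lambda>(i, j). if i = j then (e # es) ! i else 0)"
    by (intro eq_matI) (auto simp: A1_def n nth_Cons')
  ultimately show ?case using len n by auto
qed

text \<open>The vectors \<open>u a\<close> are the columns of the diagonalising unitary, and the two
  sum rules are its two unitarity relations. Vectors are numbered from 0 and eigenvalues from 1,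
  whence \<open>Suc a\<close>.\<close>

corollary hermitian_eigenbasis:
  fixes l :: "nat \<Rightarrow> real"
  assumes A: "hermitian_mat n A" and cp: "char_poly A = (\<Prod>j\<in>{1..n}. [:- complex_of_real (l j), 1:])"
  obtains u :: "nat \<Rightarrow> nat \<Rightarrow> complex"
  where "\<And>a b. a < n \<Longrightarrow> b < n \<Longrightarrow> (\<Sum>x<n. cnj (u a x) * u b x) = of_bool (a = b)"
    and "\<And>x y. x < n \<Longrightarrow> y < n \<Longrightarrow> (\<Sum>a<n. u a x * cnj (u a y)) = of_bool (x = y)"
    and "\<And>x y. x < n \<Longrightarrow> y < n \<Longrightarrow>
      A $$ (x, y) = (\<Sum>a<n. of_real (l (Suc a)) * (u a x * cnj (u a y)))"
proof -
  define es where "es = map (\<lambda>j. complex_of_real (l (Suc j))) [0..<n]"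
  have "char_poly A = (\<Prod>e\<leftarrow>es. [:- e, 1:])"
    unfolding cp es_def by (simp add: o_def prod.list_conv_set_nth atLeast0LessThan
        atLeastAtMost_insertL prod.atLeast1_atMost_eq)
  from hermitian_unitary_diagonalization[OF A this] obtain P where
    P: "similar_mat_wit A (mat n n (\<lambda>(i, j). if i = j then es ! i else 0)) P (ctrans P)" by blast
  let ?B = "mat n n (\<lambda>(i, j). if i = j then es ! i else 0)"
  have Ac: "A \<in> carrier_mat n n" using A by (simp add: hermitian_mat_def)
  note w = similar_mat_witD2[OF Ac P]
  have Pc: "P \<in> carrier_mat n n" and cPc: "ctrans P \<in> carrier_mat n n" using w by auto
  define u where "u a x = P $$ (x, a)" for a x
  show ?thesis
  proof (rule that[of u])
    fix a b assume ab: "a < n" "b < n"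
    have "(ctrans P * P) $$ (a, b) = (\<Sum>x<n. cnj (u a x) * u b x)"
      using mat_mult_index_sum[OF cPc Pc ab] Pc ab by (simp add: u_def)
    moreover have "(ctrans P * P) $$ (a, b) = of_bool (a = b)" unfolding w(2) using ab by simp
    ultimately show "(\<Sum>x<n. cnj (u a x) * u b x) = of_bool (a = b)" by simp
  next
    fix x y assume xy: "x < n" "y < n"
    have "(P * ctrans P) $$ (x, y) = (\<Sum>a<n. u a x * cnj (u a y))"
      using mat_mult_index_sum[OF Pc cPc xy] Pc xy by (simp add: u_def)
    moreover have "(P * ctrans P) $$ (x, y) = of_bool (x = y)" unfolding w(1) using xy by simp
    ultimately show "(\<Sum>a<n. u a x * cnj (u a y)) = of_bool (x = y)" by simp
    have PB: "(P * ?B) $$ (x, a) = P $$ (x, a) * of_real (l (Suc a))" if "a < n" for a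
    proof -
      have "(P * ?B) $$ (x, a) = (\<Sum>k<n. P $$ (x, k) * ?B $$ (k, a))"
        by (rule mat_mult_index_sum[OF Pc _ xy(1) that]) simp
      also have "\<dots> = (\<Sum>k<n. if k = a then P $$ (x, a) * es ! a else 0)"
        using that by (intro sum.cong) auto
      finally show ?thesis using that by (simp add: es_def)
    qed
    have "A $$ (x, y) = (\<Sum>a<n. (P * ?B) $$ (x, a) * ctrans P $$ (a, y))"
      using mat_mult_index_sum[OF _ cPc xy, of "P * ?B"] w(3) Pc by simp
    also have "\<dots> = (\<Sum>a<n. of_real (l (Suc a)) * (u a x * cnj (u a y)))"
      using PB Pc xy by (intro sum.cong) (auto simp: u_def simp del: index_mult_mat)
    finally show "A $$ (x, y) = (\<Sum>a<n. of_real (l (Suc a)) * (u a x * cnj (u a y)))" .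
  qed
qed

section \<open>Digits and symmetric distributions\<close>

definition undig :: "nat \<Rightarrow> nat \<Rightarrow> (nat \<Rightarrow> nat) \<Rightarrow> nat" where
  "undig D n d = (\<Sum>k<n. d k * D ^ k)"

lemma perm_index_undig: "perm_index D n \<sigma> i = undig D n (\<lambda>k. dig D (\<sigma> k) i)"
  by (simp add: perm_index_def undig_def)

lemma dig_less: "0 < D \<Longrightarrow> dig D k i < D"
  by (simp add: dig_def)

lemma undig_dig_mod: "undig D n (\<lambda>k. dig D k m) = m mod D ^ n"
proof (induction n)
  case (Suc n)
  have "m mod D ^ Suc n = m mod (D ^ n * D)" by (simp add: mult.commute)
  also have "\<dots> = D ^ n * (m div D ^ n mod D) + m mod D ^ n" by (rule mod_mult2_eq)
  finally show ?case using Suc by (simp add: undig_def dig_def)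
qed (simp add: undig_def)

lemma undig_dig: "m < D ^ n \<Longrightarrow> undig D n (\<lambda>k. dig D k m) = m"
  by (simp add: undig_dig_mod)

lemma undig_less:
  assumes "\<And>k. k < n \<Longrightarrow> d k < D"
  shows "undig D n d < D ^ n"
  using assms
proof (induction n)
  case (Suc n)
  have IH: "undig D n d < D ^ n" using Suc by auto
  have "undig D (Suc n) d = undig D n d + d n * D ^ n" by (simp add: undig_def)
  also have "\<dots> < D ^ n + d n * D ^ n" using IH by simp
  also have "\<dots> = (d n + 1) * D ^ n" by simp
  also have "\<dots> \<le> D * D ^ n" using Suc.prems[of n] by (intro mult_right_mono) auto
  finally show ?case by simp
qed (simp add: undig_def)

lemma dig_add_top:
  assumes "m < D ^ n"
  shows "k < n \<Longrightarrow> dig D k (a * D ^ n + m) = dig D k m"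
    and "a < D \<Longrightarrow> dig D n (a * D ^ n + m) = a"
proof -
  assume k: "k < n"
  have D: "0 < D ^ k" using assms k by (cases "D = 0") (auto simp: zero_power)
  obtain j where n: "n = k + Suc j" using k less_imp_Suc_add by auto
  have "(a * D ^ n + m) div D ^ k = (m + (a * D ^ j * D) * D ^ k) div D ^ k"
    by (simp add: n power_add algebra_simps)
  also have "\<dots> = a * D ^ j * D + m div D ^ k" using D by (subst div_mult_self1) auto
  finally show "dig D k (a * D ^ n + m) = dig D k m" by (simp add: dig_def)
next
  assume "a < D"
  then show "dig D n (a * D ^ n + m) = a" using assms by (simp add: dig_def)
qed

lemma dig_undig:
  assumes "\<And>k. k < n \<Longrightarrow> d k < D" "k < n"
  shows "dig D k (undig D n d) = d k"
  using assms
proof (induction n)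
  case (Suc n)
  have less: "undig D n d < D ^ n" using Suc.prems by (intro undig_less) auto
  have eq: "undig D (Suc n) d = d n * D ^ n + undig D n d" by (simp add: undig_def)
  show ?case
  proof (cases "k = n")
    case True
    then show ?thesis unfolding eq using dig_add_top(2)[OF less] Suc.prems(1)[of n] by simp
  next
    case False
    then show ?thesis unfolding eq using dig_add_top(1)[OF less] Suc by auto
  qed
qed simp

lemma dig_eqI:
  assumes "i < D ^ n" "j < D ^ n" "\<And>k. k < n \<Longrightarrow> dig D k i = dig D k j"
  shows "i = j"
proof -
  have "undig D n (\<lambda>k. dig D k i) = undig D n (\<lambda>k. dig D k j)"
    using assms(3) by (simp add: undig_def)
  then show ?thesis using assms by (simp add: undig_dig)
qed

text \<open>The indices below \<open>D ^ n\<close> run through all words of length \<open>n\<close>,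
  so this is general distributivity. The induction splits the indices into blocks of equal leading
  digit.\<close>

lemma sum_prod_dig:
  fixes g :: "nat \<Rightarrow> nat \<Rightarrow> 'a::comm_semiring_1"
  shows "(\<Sum>m<D ^ n. \<Prod>k<n. g k (dig D k m)) = (\<Prod>k<n. \<Sum>a<D. g k a)"
proof (induction n)
  case (Suc n)
  let ?G = "\<lambda>n m. \<Prod>k<n. g k (dig D k m)"
  have inner: "(\<Sum>m\<in>{a * D ^ n..<a * D ^ n + D ^ n}. ?G (Suc n) m)
      = (\<Sum>m<D ^ n. ?G n m) * g n a" if a: "a < D" for a
  proof -
    have "(\<Sum>m\<in>{a * D ^ n..<a * D ^ n + D ^ n}. ?G (Suc n) m)
        = (\<Sum>m<D ^ n. ?G (Suc n) (a * D ^ n + m))"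
      by (rule sum.reindex_bij_witness[of _ "\<lambda>m. a * D ^ n + m" "\<lambda>m. m - a * D ^ n"]) auto
    also have "\<dots> = (\<Sum>m<D ^ n. ?G n m * g n a)"
      using a by (intro sum.cong refl) (simp add: dig_add_top)
    finally show ?thesis by (simp add: sum_distrib_right)
  qed
  have "(\<Sum>m<D ^ Suc n. ?G (Suc n) m)
      = (\<Sum>a<D. \<Sum>m\<in>{a * D ^ n..<a * D ^ n + D ^ n}. ?G (Suc n) m)"
    by (simp only: sum.nat_group power_Suc)
  also have "\<dots> = (\<Sum>a<D. (\<Sum>m<D ^ n. ?G n m) * g n a)" by (intro sum.cong refl inner) auto
  also have "\<dots> = (\<Sum>m<D ^ n. ?G n m) * (\<Sum>a<D. g n a)" by (simp add: sum_distrib_left)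
  finally show ?case using Suc by simp
qed simp

lemma prod_of_bool_dig:
  assumes "i < D ^ n" "j < D ^ n"
  shows "(\<Prod>k<n. of_bool (dig D k i = dig D k j)) = (of_bool (i = j) :: 'a::comm_semiring_1)"
proof (cases "i = j")
  case False
  then obtain k where "k < n" "dig D k i \<noteq> dig D k j" using dig_eqI[OF assms] by blast
  then show ?thesis using False by (auto simp: prod_zero_iff intro!: prod_zero)
qed simp

section \<open>Permutations of the positions of a word\<close>

lemma dig_perm_index:
  "0 < D \<Longrightarrow> k < n \<Longrightarrow> dig D k (perm_index D n \<sigma> i) = dig D (\<sigma> k) i"
  unfolding perm_index_undig by (rule dig_undig) (auto simp: dig_less)

lemma perm_index_less: "0 < D \<Longrightarrow> perm_index D n \<sigma> i < D ^ n"
  unfolding perm_index_undig by (rule undig_less) (auto simp: dig_less)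

lemma perm_index_inv:
  assumes "0 < D" "\<sigma> permutes {..<n}" "\<tau> permutes {..<n}" "\<And>k. \<tau> (\<sigma> k) = k" "i < D ^ n"
  shows "perm_index D n \<sigma> (perm_index D n \<tau> i) = i"
proof (rule dig_eqI)
  fix k assume k: "k < n"
  then have "\<sigma> k < n" using permutes_in_image[OF assms(2), of k] by auto
  then show "dig D k (perm_index D n \<sigma> (perm_index D n \<tau> i)) = dig D k i"
    using assms k by (simp add: dig_perm_index)
qed (use assms in \<open>auto simp: perm_index_less\<close>)

lemma sum_perm_index:
  assumes D: "0 < D" and \<sigma>: "\<sigma> permutes {..<n}"
  shows "(\<Sum>m<D ^ n. g (perm_index D n \<sigma> m)) = (\<Sum>m<D ^ n. g m)"
proof (rule sum.reindex_bij_witness[of _ "perm_index D n (inv_into UNIV \<sigma>)" "perm_index D n \<sigma>"])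
  have inv: "inv_into UNIV \<sigma> permutes {..<n}" using permutes_inv[OF \<sigma>] .
  fix i assume "i \<in> {..<D ^ n}"
  then show "perm_index D n (inv_into UNIV \<sigma>) (perm_index D n \<sigma> i) = i"
    "perm_index D n \<sigma> (perm_index D n (inv_into UNIV \<sigma>) i) = i"
    using perm_index_inv[OF D] \<sigma> inv permutes_inverses[OF \<sigma>] by auto
qed (auto simp: perm_index_less D)

text \<open>The classical counterpart of a permutation-invariant density operator. An index
  \<open>m\<close> stands for the word of its base-\<open>D\<close> digits, each digit naming an
  eigenvector.\<close>

definition symdist :: "nat \<Rightarrow> nat \<Rightarrow> (nat \<Rightarrow> real) \<Rightarrow> bool" where
  "symdist D n q \<longleftrightarrow> (\<forall>m<D ^ n. 0 \<le> q m) \<and> (\<Sum>m<D ^ n. q m) = 1 \<and>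
     (\<forall>\<sigma>. \<sigma> permutes {..<n} \<longrightarrow> (\<forall>m<D ^ n. q (perm_index D n \<sigma> m) = q m))"

text \<open>The values of \<open>p\<close> and \<open>f\<close> on the diagonal state with weights \<open>q\<close> in an eigenbasis with
  eigenvalues \<open>l\<close>, where index \<open>0\<close> is the target state.\<close>

definition pass_prob :: "nat \<Rightarrow> nat \<Rightarrow> (nat \<Rightarrow> real) \<Rightarrow> (nat \<Rightarrow> real) \<Rightarrow> real" where
  "pass_prob D N l q = (\<Sum>m<D ^ (N + 1). (\<Prod>k<N. l (dig D k m)) * q m)"

definition pass_fid :: "nat \<Rightarrow> nat \<Rightarrow> (nat \<Rightarrow> real) \<Rightarrow> (nat \<Rightarrow> real) \<Rightarrow> real" where
  "pass_fid D N l q = (\<Sum>m<D ^ (N + 1). (\<Prod>k<N. l (dig D k m)) * of_bool (dig D N m = 0) * q m)"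

section \<open>Measuring permutation-invariant states in a product eigenbasis\<close>

text \<open>Only the projections onto \<Psi> and \<open>u 0\<close> are identified, since a unit
  eigenvector is determined up to a phase.\<close>

locale eigenbasis =
  fixes D :: nat and \<Psi> :: "complex vec" and u :: "nat \<Rightarrow> nat \<Rightarrow> complex"
  assumes D_ge_2: "2 \<le> D"
    and orthonormal: "\<And>a b. a < D \<Longrightarrow> b < D \<Longrightarrow> (\<Sum>x<D. cnj (u a x) * u b x) = of_bool (a = b)"
    and complete: "\<And>x y. x < D \<Longrightarrow> y < D \<Longrightarrow> (\<Sum>a<D. u a x * cnj (u a y)) = of_bool (x = y)"
    and target: "\<And>x y. x < D \<Longrightarrow> y < D \<Longrightarrow> \<Psi> $ x * cnj (\<Psi> $ y) = u 0 x * cnj (u 0 y)"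
begin

definition spectral :: "complex mat \<Rightarrow> (nat \<Rightarrow> real) \<Rightarrow> bool" where
  "spectral A l \<longleftrightarrow> (\<forall>x<D. \<forall>y<D. A $$ (x, y) = (\<Sum>a<D. of_real (l a) * (u a x * cnj (u a y))))"

text \<open>Both arguments are words in the same digit encoding: \<open>m\<close> lists eigenvector
  labels, \<open>i\<close> lists coordinates.\<close>

definition prodvec :: "nat \<Rightarrow> nat \<Rightarrow> nat \<Rightarrow> complex" where
  "prodvec n m i = (\<Prod>k<n. u (dig D k m) (dig D k i))"

lemma D_pos: "0 < D"
  using D_ge_2 by simp

lemma dig_less_D [simp]: "dig D k i < D"
  using dig_less[OF D_pos] .

lemma prodvec_orthonormal:
  assumes "m < D ^ n" "m' < D ^ n"
  shows "(\<Sum>i<D ^ n. cnj (prodvec n m i) * prodvec n m' i) = of_bool (m = m')"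
proof -
  have "(\<Sum>i<D ^ n. cnj (prodvec n m i) * prodvec n m' i)
      = (\<Sum>i<D ^ n. \<Prod>k<n. (\<lambda>k x. cnj (u (dig D k m) x) * u (dig D k m') x) k (dig D k i))"
    by (simp add: prodvec_def prod.distrib)
  also have "\<dots> = (\<Prod>k<n. \<Sum>x<D. cnj (u (dig D k m) x) * u (dig D k m') x)"
    by (subst sum_prod_dig) simp
  also have "\<dots> = (\<Prod>k<n. of_bool (dig D k m = dig D k m'))"
    by (simp add: orthonormal)
  finally show ?thesis using prod_of_bool_dig[OF assms] by simp
qed

text \<open>Each position may have its own operator, because the last tensor factor of the
  observables differs from the tested ones.\<close>

lemma prodvec_expansion:
  assumes "\<And>k. k < n \<Longrightarrow> spectral (A k) (c k)"
  shows "(\<Prod>k<n. A k $$ (dig D k i, dig D k j))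
    = (\<Sum>m<D ^ n. of_real (\<Prod>k<n. c k (dig D k m)) * (prodvec n m i * cnj (prodvec n m j)))"
proof -
  have "(\<Prod>k<n. A k $$ (dig D k i, dig D k j))
      = (\<Prod>k<n. \<Sum>a<D. (\<lambda>k a. of_real (c k a) * (u a (dig D k i) * cnj (u a (dig D k j)))) k a)"
    using assms by (intro prod.cong) (auto simp: spectral_def)
  also have "\<dots> = (\<Sum>m<D ^ n. \<Prod>k<n. of_real (c k (dig D k m)) *
      (u (dig D k m) (dig D k i) * cnj (u (dig D k m) (dig D k j))))"
    by (subst sum_prod_dig[symmetric]) simp
  finally show ?thesis by (simp add: prodvec_def prod.distrib)
qed

lemma spectral_one: "spectral (1\<^sub>m D) (\<lambda>_. 1)"
  by (auto simp: spectral_def complete)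

lemma spectral_proj: "spectral (proj D \<Psi>) (\<lambda>a. of_bool (a = 0))"
  unfolding spectral_def
proof (intro allI impI)
  fix x y assume xy: "x < D" "y < D"
  have "(\<Sum>a<D. of_real (of_bool (a = 0)) * (u a x * cnj (u a y)))
      = (\<Sum>a<D. if a = 0 then u 0 x * cnj (u 0 y) else 0)"
    by (intro sum.cong) auto
  also have "\<dots> = u 0 x * cnj (u 0 y)" using D_pos by simp
  finally show "proj D \<Psi> $$ (x, y) = (\<Sum>a<D. of_real (of_bool (a = 0)) * (u a x * cnj (u a y)))"
    using target[OF xy] xy by (simp add: proj_def)
qed

lemma spectral_hom_op: "spectral (hom_op D \<Psi> r) (\<lambda>a. if a = 0 then 1 else r)"
  unfolding spectral_def
proof (intro allI impI)
  fix x y assume xy: "x < D" "y < D"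
  let ?g = "\<lambda>a. u a x * cnj (u a y)"
  have P: "proj D \<Psi> $$ (x, y) = (\<Sum>a<D. of_real (of_bool (a = 0)) * ?g a)"
    using spectral_proj xy unfolding spectral_def by blast
  have I: "1\<^sub>m D $$ (x, y) = (\<Sum>a<D. ?g a)"
    using complete[OF xy] xy by simp
  have "hom_op D \<Psi> r $$ (x, y)
      = proj D \<Psi> $$ (x, y) + of_real r * (1\<^sub>m D $$ (x, y) - proj D \<Psi> $$ (x, y))"
    using xy by (simp add: hom_op_def proj_def)
  also have "\<dots> = (\<Sum>a<D. of_real (of_bool (a = 0)) * ?g a
      + of_real r * (?g a - of_real (of_bool (a = 0)) * ?g a))"
    unfolding P I by (simp add: sum.distrib sum_subtractf right_diff_distrib sum_distrib_left)
  also have "\<dots> = (\<Sum>a<D. of_real (if a = 0 then 1 else r) * ?g a)"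
    by (intro sum.cong) auto
  finally show "hom_op D \<Psi> r $$ (x, y) = (\<Sum>a<D. of_real (if a = 0 then 1 else r) * ?g a)" .
qed

section \<open>Outcome distributions of measurements in the product eigenbasis\<close>

definition diagonal :: "nat \<Rightarrow> complex mat \<Rightarrow> nat \<Rightarrow> real" where
  "diagonal n \<rho> m = Re (qform (D ^ n) \<rho> (vec (D ^ n) (prodvec n m)))"

lemma qform_prodvec:
  "qform (D ^ n) \<rho> (vec (D ^ n) (prodvec n m))
    = (\<Sum>i<D ^ n. \<Sum>j<D ^ n. cnj (prodvec n m i) * \<rho> $$ (i, j) * prodvec n m j)"
  unfolding qform_def by (intro sum.cong refl) auto

text \<open>An observable diagonal in the product eigenbasis sees only the diagonal of the state
  there: expanding \<open>T\<close> and moving the sum over \<open>m\<close> outwards leaves one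
  quadratic form per product vector.\<close>

lemma trace_expansion:
  fixes c :: "nat \<Rightarrow> real"
  assumes T: "T \<in> carrier_mat (D ^ n) (D ^ n)" and \<rho>: "\<rho> \<in> carrier_mat (D ^ n) (D ^ n)"
    and Tc: "\<And>i j. i < D ^ n \<Longrightarrow> j < D ^ n \<Longrightarrow>
      T $$ (i, j) = (\<Sum>m<D ^ n. of_real (c m) * (prodvec n m i * cnj (prodvec n m j)))"
  shows "Re (mtrace (D ^ n) (T * \<rho>)) = (\<Sum>m<D ^ n. c m * diagonal n \<rho> m)"
proof -
  have "mtrace (D ^ n) (T * \<rho>) = (\<Sum>i<D ^ n. \<Sum>j<D ^ n. T $$ (i, j) * \<rho> $$ (j, i))"
    using T \<rho> unfolding mtrace_def
    by (intro sum.cong) (auto simp: scalar_prod_def lessThan_atLeast0 intro!: sum.cong)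
  also have "\<dots> = (\<Sum>i<D ^ n. \<Sum>j<D ^ n. \<Sum>m<D ^ n.
      of_real (c m) * (cnj (prodvec n m j) * \<rho> $$ (j, i) * prodvec n m i))"
    by (intro sum.cong refl) (simp add: Tc sum_distrib_right sum_distrib_left algebra_simps)
  also have "\<dots> = (\<Sum>m<D ^ n. \<Sum>i<D ^ n. \<Sum>j<D ^ n.
      of_real (c m) * (cnj (prodvec n m j) * \<rho> $$ (j, i) * prodvec n m i))"
  proof -
    have "(\<Sum>i<D ^ n. \<Sum>j<D ^ n. \<Sum>m<D ^ n. h i j m) = (\<Sum>m<D ^ n. \<Sum>i<D ^ n. \<Sum>j<D ^ n. h i j m)"
      for h :: "nat \<Rightarrow> nat \<Rightarrow> nat \<Rightarrow> complex"
      by (subst sum.swap[of _ "{..<D ^ n}" "{..<D ^ n}"])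
        (subst sum.swap[of "\<lambda>m i. \<Sum>j<D ^ n. h i j m"], intro sum.cong refl sum.swap)
    then show ?thesis .
  qed
  also have "\<dots> = (\<Sum>m<D ^ n. of_real (c m) * qform (D ^ n) \<rho> (vec (D ^ n) (prodvec n m)))"
    unfolding qform_prodvec sum_distrib_left by (intro sum.cong refl sum.swap)
  finally show ?thesis by (simp add: diagonal_def)
qed

lemma tensor_obs_expansion:
  assumes A: "spectral A l" and P: "spectral P p"
    and ij: "i < D ^ (N + 1)" "j < D ^ (N + 1)"
  shows "tensor_obs D N A P $$ (i, j) = (\<Sum>m<D ^ (N + 1).
    of_real ((\<Prod>k<N. l (dig D k m)) * p (dig D N m)) * (prodvec (N + 1) m i * cnj (prodvec (N + 1) m j)))"
proof -
  define B where "B k = (if k < N then A else P)" for k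
  define c where "c k = (if k < N then l else p)" for k
  have "tensor_obs D N A P $$ (i, j) = (\<Prod>k<N + 1. B k $$ (dig D k i, dig D k j))"
    using ij by (simp add: tensor_obs_def B_def)
  also have "\<dots> = (\<Sum>m<D ^ (N + 1). of_real (\<Prod>k<N + 1. c k (dig D k m)) *
      (prodvec (N + 1) m i * cnj (prodvec (N + 1) m j)))"
    by (rule prodvec_expansion) (simp add: B_def c_def A P)
  finally show ?thesis by (simp add: c_def)
qed

lemma tensor_obs_carrier: "tensor_obs D N A P \<in> carrier_mat (D ^ (N + 1)) (D ^ (N + 1))"
  by (simp add: tensor_obs_def)

lemma pacc_eq_pass_prob:
  assumes "spectral A l" "\<rho> \<in> carrier_mat (D ^ (N + 1)) (D ^ (N + 1))"
  shows "pacc D N A \<rho> = pass_prob D N l (diagonal (N + 1) \<rho>)"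
  unfolding pacc_def pass_prob_def
  by (subst trace_expansion[OF tensor_obs_carrier assms(2) tensor_obs_expansion[OF assms(1) spectral_one]])
    auto

lemma facc_eq_pass_fid:
  assumes "spectral A l" "\<rho> \<in> carrier_mat (D ^ (N + 1)) (D ^ (N + 1))"
  shows "facc D \<Psi> N A \<rho> = pass_fid D N l (diagonal (N + 1) \<rho>)"
  unfolding facc_def pass_fid_def
  by (subst trace_expansion[OF tensor_obs_carrier assms(2) tensor_obs_expansion[OF assms(1) spectral_proj]])
    auto

lemma prodvec_perm:
  assumes \<sigma>: "\<sigma> permutes {..<n}"
  shows "prodvec n (perm_index D n \<sigma> m) (perm_index D n \<sigma> i) = prodvec n m i"
proof -
  have "prodvec n (perm_index D n \<sigma> m) (perm_index D n \<sigma> i)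
      = (\<Prod>k<n. u (dig D (\<sigma> k) m) (dig D (\<sigma> k) i))"
    unfolding prodvec_def by (intro prod.cong) (auto simp: dig_perm_index D_pos)
  also have "\<dots> = prodvec n m i"
    unfolding prodvec_def using prod.permute[OF \<sigma>, of "\<lambda>k. u (dig D k m) (dig D k i)"] by (simp add: o_def)
  finally show ?thesis .
qed

text \<open>Positivity gives nonnegative weights and the trace gives their sum. Invariance follows
  by permuting both summation indices of the quadratic form, which undoes the permutation of
  \<open>m\<close>.\<close>

lemma symdist_diagonal:
  assumes dens: "density_op (D ^ n) \<rho>" and inv: "perm_invariant D n \<rho>"
  shows "symdist D n (diagonal n \<rho>)"
  unfolding symdist_def
proof (intro conjI allI impI)
  have psd: "psd (D ^ n) \<rho>" and tr: "mtrace (D ^ n) \<rho> = 1" using dens by (auto simp: density_op_def)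
  have \<rho>: "\<rho> \<in> carrier_mat (D ^ n) (D ^ n)" using psd by (auto simp: psd_def hermitian_mat_def)
  show "0 \<le> diagonal n \<rho> m" for m
    unfolding diagonal_def using psd by (auto simp: psd_def)
  \<comment> \<open>The identity is a tensor power of the one-system identity, so all its
    coefficients are 1 and the trace expansion returns the sum of the weights.\<close>
  have "1\<^sub>m (D ^ n) $$ (i, j) = (\<Sum>m<D ^ n. of_real 1 * (prodvec n m i * cnj (prodvec n m j)))"
    if "i < D ^ n" "j < D ^ n" for i j
  proof -
    have "(\<Sum>m<D ^ n. of_real (\<Prod>k<n. 1) * (prodvec n m i * cnj (prodvec n m j)))
        = (\<Prod>k<n. 1\<^sub>m D $$ (dig D k i, dig D k j))"
      by (rule prodvec_expansion[symmetric]) (rule spectral_one)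
    also have "\<dots> = (\<Prod>k<n. of_bool (dig D k i = dig D k j))" by (intro prod.cong) auto
    finally show ?thesis using that by (simp add: prod_of_bool_dig)
  qed
  from trace_expansion[OF one_carrier_mat \<rho> this] show "(\<Sum>m<D ^ n. diagonal n \<rho> m) = 1"
    using \<rho> tr by simp
  fix \<sigma> m assume \<sigma>: "\<sigma> permutes {..<n}" and m: "m < D ^ n"
  let ?p = "perm_index D n \<sigma>"
  let ?g = "\<lambda>m i j. cnj (prodvec n m i) * \<rho> $$ (i, j) * prodvec n m j"
  have "(\<Sum>i<D ^ n. \<Sum>j<D ^ n. ?g (?p m) i j) = (\<Sum>i<D ^ n. \<Sum>j<D ^ n. ?g (?p m) (?p i) j)"
    by (rule sum_perm_index[OF D_pos \<sigma>, symmetric])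
  also have "\<dots> = (\<Sum>i<D ^ n. \<Sum>j<D ^ n. ?g (?p m) (?p i) (?p j))"
    by (intro sum.cong refl sum_perm_index[OF D_pos \<sigma>, symmetric])
  also have "\<dots> = (\<Sum>i<D ^ n. \<Sum>j<D ^ n. ?g m i j)"
    using inv \<sigma> by (intro sum.cong refl) (simp add: prodvec_perm[OF \<sigma>] perm_invariant_def)
  finally show "diagonal n \<rho> (?p m) = diagonal n \<rho> m"
    unfolding diagonal_def qform_prodvec by simp
qed

section \<open>Diagonal states with prescribed outcome distribution\<close>

definition state :: "nat \<Rightarrow> (nat \<Rightarrow> real) \<Rightarrow> complex mat" where
  "state n q = mat (D ^ n) (D ^ n)
    (\<lambda>(i, j). \<Sum>m<D ^ n. of_real (q m) * (prodvec n m i * cnj (prodvec n m j)))"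

lemma state_carrier: "state n q \<in> carrier_mat (D ^ n) (D ^ n)"
  by (simp add: state_def)

text \<open>As a weighted sum of squared overlaps the form is visibly nonnegative, and at a product
  vector orthonormality leaves a single term.\<close>

lemma qform_state:
  "qform (D ^ n) (state n q) v
    = (\<Sum>m<D ^ n. of_real (q m * (cmod (\<Sum>i<D ^ n. cnj (prodvec n m i) * v $ i))\<^sup>2))"
proof -
  have "qform (D ^ n) (state n q) v = (\<Sum>i<D ^ n. \<Sum>j<D ^ n. \<Sum>m<D ^ n.
      of_real (q m) * (cnj (cnj (prodvec n m i) * v $ i) * (cnj (prodvec n m j) * v $ j)))"
    unfolding qform_def
    by (intro sum.cong refl) (simp add: state_def sum_distrib_left sum_distrib_right algebra_simps)
  also have "\<dots> = (\<Sum>i<D ^ n. \<Sum>m<D ^ n. \<Sum>j<D ^ n.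
      of_real (q m) * (cnj (cnj (prodvec n m i) * v $ i) * (cnj (prodvec n m j) * v $ j)))"
    by (intro sum.cong refl sum.swap)
  also have "\<dots> = (\<Sum>m<D ^ n. \<Sum>i<D ^ n. \<Sum>j<D ^ n.
      of_real (q m) * (cnj (cnj (prodvec n m i) * v $ i) * (cnj (prodvec n m j) * v $ j)))"
    by (rule sum.swap)
  also have "\<dots> = (\<Sum>m<D ^ n. of_real (q m) *
      (cnj (\<Sum>i<D ^ n. cnj (prodvec n m i) * v $ i) * (\<Sum>j<D ^ n. cnj (prodvec n m j) * v $ j)))"
    unfolding cnj_sum unfolding sum_product unfolding sum_distrib_left ..
  also have "\<dots> = (\<Sum>m<D ^ n. of_real (q m * (cmod (\<Sum>i<D ^ n. cnj (prodvec n m i) * v $ i))\<^sup>2))"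
    by (intro sum.cong refl) (simp only: of_real_mult complex_norm_square mult.commute)
  finally show ?thesis .
qed

lemma diagonal_state:
  assumes "m < D ^ n"
  shows "diagonal n (state n q) m = q m"
proof -
  have "(\<Sum>i<D ^ n. cnj (prodvec n m' i) * vec (D ^ n) (prodvec n m) $ i) = of_bool (m' = m)" if "m' < D ^ n" for m'
    using prodvec_orthonormal[OF that assms] by simp
  then have "qform (D ^ n) (state n q) (vec (D ^ n) (prodvec n m))
      = (\<Sum>m'<D ^ n. if m' = m then of_real (q m) else 0)"
    unfolding qform_state by (intro sum.cong refl) auto
  then show ?thesis using assms by (simp add: diagonal_def)
qed

lemma density_op_state:
  assumes "symdist D n q"
  shows "density_op (D ^ n) (state n q)"
  unfolding density_op_def psd_def hermitian_mat_def
proof (intro conjI allI impI ballI)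
  have q: "\<And>m. m < D ^ n \<Longrightarrow> 0 \<le> q m" and q1: "(\<Sum>m<D ^ n. q m) = 1"
    using assms by (auto simp: symdist_def)
  show "state n q $$ (i, j) = cnj (state n q $$ (j, i))" if "i < D ^ n" "j < D ^ n" for i j
    using that by (simp add: state_def algebra_simps)
  show "0 \<le> Re (qform (D ^ n) (state n q) v)" for v
    unfolding qform_state using q by (auto intro!: sum_nonneg)
  have "mtrace (D ^ n) (state n q)
      = (\<Sum>i<D ^ n. \<Sum>m<D ^ n. of_real (q m) * (cnj (prodvec n m i) * prodvec n m i))"
    unfolding mtrace_def by (intro sum.cong refl) (simp add: state_def algebra_simps)
  also have "\<dots> = (\<Sum>m<D ^ n. of_real (q m) * (\<Sum>i<D ^ n. cnj (prodvec n m i) * prodvec n m i))"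
    by (subst sum.swap) (simp add: sum_distrib_left)
  also have "\<dots> = of_real (\<Sum>m<D ^ n. q m)" by (simp add: prodvec_orthonormal)
  finally show "mtrace (D ^ n) (state n q) = 1" using q1 by simp
qed (rule state_carrier)

lemma perm_invariant_state:
  assumes "symdist D n q"
  shows "perm_invariant D n (state n q)"
  unfolding perm_invariant_def
proof (intro allI impI)
  fix \<sigma> i j assume \<sigma>: "\<sigma> permutes {..<n}" and ij: "i < D ^ n" "j < D ^ n"
  let ?p = "perm_index D n \<sigma>"
  have "state n q $$ (?p i, ?p j) = (\<Sum>m<D ^ n. of_real (q m) * (prodvec n m (?p i) * cnj (prodvec n m (?p j))))"
    by (simp add: state_def perm_index_less D_pos)
  also have "\<dots> = (\<Sum>m<D ^ n. of_real (q (?p m)) * (prodvec n (?p m) (?p i) * cnj (prodvec n (?p m) (?p j))))"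
    by (rule sum_perm_index[OF D_pos \<sigma>, symmetric])
  also have "\<dots> = state n q $$ (i, j)"
    using assms \<sigma> ij by (auto simp: state_def prodvec_perm[OF \<sigma>] symdist_def)
  finally show "state n q $$ (?p i, ?p j) = state n q $$ (i, j)" .
qed

section \<open>The minimal fidelity as an infimum over distributions\<close>

lemma pass_prob_fid_cong:
  assumes "\<And>m. m < D ^ (N + 1) \<Longrightarrow> q m = q' m"
  shows "pass_prob D N l q = pass_prob D N l q'" "pass_fid D N l q = pass_fid D N l q'"
  using assms by (simp_all add: pass_prob_def pass_fid_def)

lemma symdist_point: "symdist D n (\<lambda>m. of_bool (m = 0))"
  unfolding symdist_def
proof (intro conjI allI impI)
  have D: "0 < D ^ n" using D_pos by simp
  have "(\<Sum>m<D ^ n. of_bool (m = 0)) = (\<Sum>m<D ^ n. if m = 0 then 1 else 0 :: real)"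
    by (intro sum.cong) auto
  then show "(\<Sum>m<D ^ n. of_bool (m = 0)) = (1::real)" using D by simp
  fix \<sigma> m assume \<sigma>: "\<sigma> permutes {..<n}" and m: "m < D ^ n"
  \<comment> \<open>Every permutation fixes the all-target word; by invertibility no other word is
    sent to it.\<close>
  have z: "perm_index D n \<tau> 0 = 0" for \<tau> by (simp add: perm_index_def dig_def)
  have "perm_index D n (inv_into UNIV \<sigma>) (perm_index D n \<sigma> m) = m"
    using perm_index_inv[OF D_pos permutes_inv[OF \<sigma>] \<sigma> _ m] permutes_inverses[OF \<sigma>] by auto
  then have "perm_index D n \<sigma> m = 0 \<longleftrightarrow> m = 0" using z by metis
  then show "of_bool (perm_index D n \<sigma> m = 0) = (of_bool (m = 0) :: real)" by simp
qed simp

lemma pass_prob_point: "l 0 = 1 \<Longrightarrow> pass_prob D N l (\<lambda>m. of_bool (m = 0)) = 1"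
proof -
  assume l: "l 0 = 1"
  have "pass_prob D N l (\<lambda>m. of_bool (m = 0)) = (\<Sum>m<D ^ (N + 1). if m = 0 then 1 else 0)"
    unfolding pass_prob_def using l by (intro sum.cong) (auto simp: dig_def)
  then show ?thesis using D_pos by simp
qed

lemma pass_fid_nonneg:
  assumes "\<And>a. a < D \<Longrightarrow> 0 \<le> l a" "symdist D (N + 1) q"
  shows "0 \<le> pass_fid D N l q"
  unfolding pass_fid_def using assms
  by (intro sum_nonneg mult_nonneg_nonneg prod_nonneg) (auto simp: symdist_def)

text \<open>Taking diagonals of states, and conversely diagonal states of distributions, shows that
  both produce the same set of ratios. Denominators are at least \<open>\<delta> > 0\<close> and can
  be cleared, which leaves a condition linear in \<open>q\<close>.\<close>

lemma Fmin_ge_iff: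
  assumes A: "spectral A l" and l: "\<And>a. a < D \<Longrightarrow> 0 \<le> l a" "l 0 = 1"
    and \<delta>: "0 < \<delta>" "\<delta> \<le> 1"
  shows "F \<le> Fmin D \<Psi> N \<delta> A \<longleftrightarrow>
    (\<forall>q. symdist D (N + 1) q \<and> \<delta> \<le> pass_prob D N l q \<longrightarrow> F * pass_prob D N l q \<le> pass_fid D N l q)"
proof -
  define S where "S = {facc D \<Psi> N A \<rho> / pacc D N A \<rho> | \<rho>.
      density_op (D ^ (N + 1)) \<rho> \<and> perm_invariant D (N + 1) \<rho> \<and> pacc D N A \<rho> \<ge> \<delta>}"
  define R where "R = {pass_fid D N l q / pass_prob D N l q | q. symdist D (N + 1) q \<and> \<delta> \<le> pass_prob D N l q}"
  have "S = R"
  proof (intro equalityI subsetI)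
    fix x assume "x \<in> S"
    then obtain \<rho> where x: "x = facc D \<Psi> N A \<rho> / pacc D N A \<rho>"
      and \<rho>: "density_op (D ^ (N + 1)) \<rho>" "perm_invariant D (N + 1) \<rho>" "pacc D N A \<rho> \<ge> \<delta>"
      unfolding S_def by blast
    have c: "\<rho> \<in> carrier_mat (D ^ (N + 1)) (D ^ (N + 1))"
      using \<rho>(1) unfolding density_op_def psd_def hermitian_mat_def by blast
    have "x = pass_fid D N l (diagonal (N + 1) \<rho>) / pass_prob D N l (diagonal (N + 1) \<rho>)"
      unfolding x pacc_eq_pass_prob[OF A c] facc_eq_pass_fid[OF A c] ..
    then show "x \<in> R" using symdist_diagonal[OF \<rho>(1,2)] \<rho>(3)
      unfolding R_def pacc_eq_pass_prob[OF A c] by blast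
  next
    fix x assume "x \<in> R"
    then obtain q where x: "x = pass_fid D N l q / pass_prob D N l q"
      and q: "symdist D (N + 1) q" "\<delta> \<le> pass_prob D N l q" unfolding R_def by blast
    let ?\<rho> = "state (N + 1) q"
    have acc: "pacc D N A ?\<rho> = pass_prob D N l q" "facc D \<Psi> N A ?\<rho> = pass_fid D N l q"
      unfolding pacc_eq_pass_prob[OF A state_carrier] facc_eq_pass_fid[OF A state_carrier]
      by (rule pass_prob_fid_cong, rule diagonal_state, assumption)+
    show "x \<in> S" unfolding S_def mem_Collect_eq
      by (intro exI[of _ ?\<rho>] conjI density_op_state perm_invariant_state q(1)) (simp_all only: acc x q)
  qed
  then have Fmin: "Fmin D \<Psi> N \<delta> A = Inf R" by (simp add: Fmin_def S_def)
  \<comment> \<open>\<open>Inf\<close> of a set of reals is meaningful only if the set is nonempty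
    and bounded below. The point mass on the all-target word has acceptance probability 1.\<close>
  have ne: "R \<noteq> {}"
    using symdist_point[of "N + 1"] pass_prob_point[of l N] l(2) \<delta>(2) unfolding R_def by fastforce
  have bdd: "bdd_below R"
  proof (rule bdd_belowI[of _ 0])
    fix x assume "x \<in> R"
    then show "0 \<le> x" using pass_fid_nonneg[OF l(1)] \<delta>(1) by (auto simp: R_def)
  qed
  have "F \<le> Inf R \<longleftrightarrow> (\<forall>x\<in>R. F \<le> x)" using le_cInf_iff[OF ne bdd] .
  also have "\<dots> \<longleftrightarrow> (\<forall>q. symdist D (N + 1) q \<and> \<delta> \<le> pass_prob D N l q \<longrightarrow> F \<le> pass_fid D N l q / pass_prob D N l q)"
    unfolding R_def by blast
  also have "\<dots> \<longleftrightarrow> (\<forall>q. symdist D (N + 1) q \<and> \<delta> \<le> pass_prob D N l q \<longrightarrow> F * pass_prob D N l q \<le> pass_fid D N l q)"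
    using \<delta>(1) by (auto simp: pos_le_divide_eq)
  finally show ?thesis unfolding Fmin .
qed

end

section \<open>Optimization over symmetric distributions\<close>

text \<open>Convexity of \<open>w * ln w\<close>: this is its tangent line at \<open>y\<close>,
  rearranged.\<close>

lemma mult_add_ln_ge:
  fixes w y :: real
  assumes "0 < w" "0 < y"
  shows "w - y \<le> w * (ln w - ln y)"
proof -
  have "ln (y / w) \<le> y / w - 1" using assms by (intro ln_le_minus_one) simp
  then have "1 - y / w \<le> ln w - ln y" using assms by (simp add: ln_div)
  then have "w * (1 - y / w) \<le> w * (ln w - ln y)" using assms by (intro mult_left_mono) auto
  moreover have "w * (1 - y / w) = w - y" using assms by (simp add: right_diff_distrib)
  ultimately show ?thesis by simp
qed

section \<open>Fidelity bounds for sufficiently many tests\<close>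

context eigenbasis
begin

text \<open>The product over the tested positions is the full product divided by the eigenvalue at
  the untested one. Swapping positions \<open>j\<close> and \<open>N\<close> preserves the full
  product and \<open>q\<close>, so each \<open>j\<close> contributes the same amount.\<close>

lemma symmetrize:
  fixes g l :: "nat \<Rightarrow> real"
  assumes l: "\<And>a. a < D \<Longrightarrow> 0 < l a" and q: "symdist D (N + 1) q"
  shows "real (N + 1) * (\<Sum>m<D ^ (N + 1). (\<Prod>k<N. l (dig D k m)) * g (dig D N m) * q m)
    = (\<Sum>m<D ^ (N + 1). (\<Prod>k<N + 1. l (dig D k m)) * (\<Sum>j<N + 1. g (dig D j m) / l (dig D j m)) * q m)"
proof -
  let ?w = "\<lambda>m. \<Prod>k<N + 1. l (dig D k m)"
  let ?t = "\<lambda>j m. ?w m * (g (dig D j m) / l (dig D j m)) * q m"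
  have last: "?t N m = (\<Prod>k<N. l (dig D k m)) * g (dig D N m) * q m" for m
    using l[OF dig_less_D, of N m] by simp
  have swap: "(\<Sum>m<D ^ (N + 1). ?t j m) = (\<Sum>m<D ^ (N + 1). ?t N m)" if j: "j < N + 1" for j
  proof -
    let ?\<sigma> = "Transposition.transpose j N"
    have \<sigma>: "?\<sigma> permutes {..<N + 1}" using j by (intro permutes_swap_id) auto
    let ?p = "perm_index D (N + 1) ?\<sigma>"
    have "?t N (?p m) = ?t j m" if m: "m < D ^ (N + 1)" for m
    proof -
      have "?w (?p m) = (\<Prod>k<N + 1. l (dig D (?\<sigma> k) m))"
        by (intro prod.cong) (auto simp: dig_perm_index D_pos)
      also have "\<dots> = ?w m"
        using prod.permute[OF \<sigma>, of "\<lambda>k. l (dig D k m)"] by (simp add: o_def)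
      finally have w: "?w (?p m) = ?w m" .
      have qm: "q (?p m) = q m" using q m \<sigma> unfolding symdist_def by blast
      have "dig D N (?p m) = dig D j m" by (simp add: dig_perm_index D_pos)
      then show ?thesis unfolding w qm by simp
    qed
    then have "(\<Sum>m<D ^ (N + 1). ?t j m) = (\<Sum>m<D ^ (N + 1). ?t N (?p m))"
      by (intro sum.cong) auto
    also have "\<dots> = (\<Sum>m<D ^ (N + 1). ?t N m)" by (rule sum_perm_index[OF D_pos \<sigma>])
    finally show ?thesis .
  qed
  have "(\<Sum>m<D ^ (N + 1). ?w m * (\<Sum>j<N + 1. g (dig D j m) / l (dig D j m)) * q m)
      = (\<Sum>m<D ^ (N + 1). \<Sum>j<N + 1. ?t j m)"
    by (simp only: sum_distrib_left sum_distrib_right)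
  also have "\<dots> = (\<Sum>j<N + 1. \<Sum>m<D ^ (N + 1). ?t j m)" by (rule sum.swap)
  also have "\<dots> = (\<Sum>j<N + 1. \<Sum>m<D ^ (N + 1). ?t N m)" by (intro sum.cong refl swap) auto
  also have "\<dots> = real (N + 1) * (\<Sum>m<D ^ (N + 1). ?t N m)" by simp
  finally show ?thesis unfolding last by simp
qed

lemma pass_prob_symmetrize:
  assumes "\<And>a. a < D \<Longrightarrow> 0 < l a" "symdist D (N + 1) q"
  shows "real (N + 1) * pass_prob D N l q
    = (\<Sum>m<D ^ (N + 1). (\<Prod>k<N + 1. l (dig D k m)) * (\<Sum>j<N + 1. 1 / l (dig D j m)) * q m)"
  using symmetrize[OF assms, where g = "\<lambda>_. 1"] unfolding pass_prob_def by simp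

lemma pass_fid_symmetrize:
  assumes "\<And>a. a < D \<Longrightarrow> 0 < l a" "symdist D (N + 1) q"
  shows "real (N + 1) * pass_fid D N l q
    = (\<Sum>m<D ^ (N + 1). (\<Prod>k<N + 1. l (dig D k m)) *
        (\<Sum>j<N + 1. of_bool (dig D j m = 0) / l (dig D j m)) * q m)"
  using symmetrize[OF assms, where g = "\<lambda>a. of_bool (a = 0)"] unfolding pass_fid_def by simp

text \<open>The letterwise bound \<open>r\<close> is affine in the logarithm of the eigenvalue, so
  summing over a word produces the logarithm of its weight. The point of tangency \<open>y\<close>
  is left free for the two choices below.\<close>

lemma gap_lower_bound:
  fixes l :: "nat \<Rightarrow> real"
  assumes q: "symdist D (N + 1) q" and l0: "l 0 = 1"
    and l: "\<And>a. 0 < a \<Longrightarrow> a < D \<Longrightarrow> 0 < l a \<and> l a \<le> \<beta> \<and> 1 / l a \<le> h * ln (1 / l a)"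
    and \<beta>: "0 < \<beta>" "\<beta> < 1" and F: "0 < F" "F < 1" and h: "0 \<le> h" and y: "0 < y" "y < 1"
    and M: "M = h * F / (1 - F) + 1 / ln (1 / \<beta>)"
    and N: "M * ln (1 / y) \<le> real (N + 1)"
  shows "(1 - F) * M * ((\<Sum>m<D ^ (N + 1). (\<Prod>k<N + 1. l (dig D k m)) * q m) - y)
    \<le> real (N + 1) * (pass_fid D N l q - F * pass_prob D N l q)"
proof -
  have lpos: "0 < l a" if "a < D" for a using l l0 that by (cases "a = 0") auto
  have q0: "0 \<le> q m" if "m < D ^ (N + 1)" for m using q that by (auto simp: symdist_def)
  have q1: "(\<Sum>m<D ^ (N + 1). q m) = 1" using q by (auto simp: symdist_def)
  have b: "0 < ln (1 / \<beta>)" using \<beta> by simp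
  have M0: "0 < M" unfolding M using b F h by (intro add_nonneg_pos) auto
  let ?w = "\<lambda>m. \<Prod>k<N + 1. l (dig D k m)"
  let ?r = "\<lambda>a. (of_bool (a = 0) - F) / l a"
  \<comment> \<open>Equality holds at the target letter. At any other letter the summand
    \<open>h * F / (1 - F)\<close> of \<open>M\<close> pays for \<open>- F / l a\<close>, and
    \<open>1 / ln (1 / \<beta>)\<close> pays for the constant \<open>1 - F\<close>.\<close>
  have r: "(1 - F) - (1 - F) * M * ln (1 / l a) \<le> ?r a" if a: "a < D" for a
  proof (cases "a = 0")
    case True
    then show ?thesis using l0 by simp
  next
    case False
    then have la: "0 < l a" "l a \<le> \<beta>" "1 / l a \<le> h * ln (1 / l a)" using l a by auto
    have "ln (1 / \<beta>) \<le> ln (1 / l a)" using la \<beta> by (simp add: frac_le)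
    then have "1 \<le> ln (1 / l a) / ln (1 / \<beta>)" using b by simp
    then have "(1 - F) * 1 \<le> (1 - F) * (ln (1 / l a) / ln (1 / \<beta>))"
      using F by (intro mult_left_mono) auto
    then have 1: "1 - F \<le> (1 - F) * (ln (1 / l a) / ln (1 / \<beta>))" by (simp only: mult_1_right)
    have 2: "F * (1 / l a) \<le> F * (h * ln (1 / l a))" using la(3) F by (intro mult_left_mono) auto
    have "(1 - F) * M * ln (1 / l a) = F * (h * ln (1 / l a)) + (1 - F) * (ln (1 / l a) / ln (1 / \<beta>))"
      unfolding M using F by (simp add: field_simps)
    then show ?thesis using 1 2 False by simp
  qed
  have point: "(1 - F) * M * (?w m - y) \<le> ?w m * (\<Sum>j<N + 1. ?r (dig D j m))" for m
  proof -
    have w: "0 < ?w m" using lpos by (intro prod_pos) auto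
    have lnw: "(\<Sum>j<N + 1. ln (1 / l (dig D j m))) = - ln (?w m)"
    proof -
      have "ln (?w m) = (\<Sum>j<N + 1. ln (l (dig D j m)))"
        using lpos[OF dig_less_D] by (intro ln_prod) (auto simp: less_imp_neq[symmetric])
      moreover have "ln (1 / l (dig D j m)) = - ln (l (dig D j m))" for j
        using lpos[OF dig_less_D, of j m] by (simp add: ln_div)
      ultimately show ?thesis by (simp only: sum_negf)
    qed
    \<comment> \<open>The tangent inequality at \<open>y\<close> leaves the term
      \<open>M * ln (1 / y)\<close>, which assumption \<open>N\<close> replaces by the number of
      systems; the letterwise bounds then apply.\<close>
    have "(1 - F) * (M * (?w m - y)) \<le> (1 - F) * (M * (?w m * (ln (?w m) - ln y)))"
      using mult_add_ln_ge[OF w y(1)] M0 F by (intro mult_left_mono) auto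
    also have "\<dots> = (1 - F) * ?w m * (M * ln (1 / y) + M * ln (?w m))"
      using y by (simp add: ln_div algebra_simps)
    also have "\<dots> \<le> (1 - F) * ?w m * (real (N + 1) + M * ln (?w m))"
      using N w F by (intro mult_left_mono) auto
    also have "\<dots> = ?w m * (real (N + 1) * (1 - F) - (1 - F) * M * (\<Sum>j<N + 1. ln (1 / l (dig D j m))))"
      unfolding lnw by (simp add: algebra_simps)
    also have "\<dots> = ?w m * (\<Sum>j<N + 1. (1 - F) - (1 - F) * M * ln (1 / l (dig D j m)))"
      by (simp only: sum_subtractf sum_constant card_lessThan sum_distrib_left right_diff_distrib)
    also have "\<dots> \<le> ?w m * (\<Sum>j<N + 1. ?r (dig D j m))"
      using w r[OF dig_less_D] by (intro mult_left_mono sum_mono) auto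
    finally show ?thesis by (simp add: mult.assoc)
  qed
  have "(1 - F) * M * ((\<Sum>m<D ^ (N + 1). ?w m * q m) - y)
      = (\<Sum>m<D ^ (N + 1). (1 - F) * M * (?w m - y) * q m)"
  proof -
    have "(\<Sum>m<D ^ (N + 1). (1 - F) * M * (?w m - y) * q m)
        = (\<Sum>m<D ^ (N + 1). (1 - F) * M * (?w m * q m) - (1 - F) * M * y * q m)"
      by (intro sum.cong refl) (simp only: right_diff_distrib left_diff_distrib mult.assoc)
    also have "\<dots> = (1 - F) * M * (\<Sum>m<D ^ (N + 1). ?w m * q m) - (1 - F) * M * y * (\<Sum>m<D ^ (N + 1). q m)"
      by (simp only: sum_subtractf sum_distrib_left)
    finally show ?thesis unfolding q1 by (simp add: right_diff_distrib)
  qed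
  also have "\<dots> \<le> (\<Sum>m<D ^ (N + 1). ?w m * (\<Sum>j<N + 1. ?r (dig D j m)) * q m)"
    using q0 point by (intro sum_mono mult_right_mono) auto
  also have "\<dots> = (\<Sum>m<D ^ (N + 1). ?w m * (\<Sum>j<N + 1. of_bool (dig D j m = 0) / l (dig D j m)) * q m
      - F * (?w m * (\<Sum>j<N + 1. 1 / l (dig D j m)) * q m))"
  proof (intro sum.cong refl)
    fix m
    have "(\<Sum>j<N + 1. ?r (dig D j m))
        = (\<Sum>j<N + 1. of_bool (dig D j m = 0) / l (dig D j m)) - F * (\<Sum>j<N + 1. 1 / l (dig D j m))"
      by (simp only: diff_divide_distrib sum_subtractf sum_distrib_left times_divide_eq_right mult_1_right)
    then show "?w m * (\<Sum>j<N + 1. ?r (dig D j m)) * q m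
        = ?w m * (\<Sum>j<N + 1. of_bool (dig D j m = 0) / l (dig D j m)) * q m
          - F * (?w m * (\<Sum>j<N + 1. 1 / l (dig D j m)) * q m)"
      by (simp only:) (simp only: right_diff_distrib left_diff_distrib mult.left_commute mult.assoc)
  qed
  also have "\<dots> = real (N + 1) * pass_fid D N l q - F * (real (N + 1) * pass_prob D N l q)"
    by (simp only: pass_fid_symmetrize[OF lpos q] pass_prob_symmetrize[OF lpos q] sum_subtractf sum_distrib_left[of F, symmetric])
  finally show ?thesis by (simp add: right_diff_distrib mult.left_commute)
qed

text \<open>Including the untested letter costs at most a factor \<tau>, so the mean word weight is
  at least \<open>\<tau> * \<delta>\<close>. With this value as \<open>y\<close> the gap bound has a
  nonnegative left side.\<close>

lemma fidelity_bound_tau: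
  fixes l :: "nat \<Rightarrow> real"
  assumes q: "symdist D (N + 1) q" and l0: "l 0 = 1"
    and l: "\<And>a. 0 < a \<Longrightarrow> a < D \<Longrightarrow> 0 < l a \<and> l a \<le> \<beta> \<and> 1 / l a \<le> h * ln (1 / l a)"
    and \<tau>: "0 < \<tau>" "\<tau> \<le> 1" "\<And>a. 0 < a \<Longrightarrow> a < D \<Longrightarrow> \<tau> \<le> l a"
    and \<beta>: "0 < \<beta>" "\<beta> < 1" and F: "0 < F" "F < 1" and h: "0 \<le> h" and \<delta>: "0 < \<delta>" "\<delta> < 1"
    and M: "M = h * F / (1 - F) + 1 / ln (1 / \<beta>)"
    and N: "M * ln (1 / (\<tau> * \<delta>)) \<le> real (N + 1)"
    and p: "\<delta> \<le> pass_prob D N l q"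
  shows "F * pass_prob D N l q \<le> pass_fid D N l q"
proof -
  have "\<tau> * \<delta> \<le> 1 * \<delta>" using \<tau> \<delta> by (intro mult_right_mono) auto
  then have "\<tau> * \<delta> < 1" using \<delta>(2) by linarith
  then have y: "0 < \<tau> * \<delta>" "\<tau> * \<delta> < 1" using \<tau>(1) \<delta>(1) by auto
  have lpos: "0 < l a" if "a < D" for a using l l0 that by (cases "a = 0") auto
  have M0: "0 \<le> M" unfolding M using \<beta> F h by (intro add_nonneg_nonneg) auto
  have "\<tau> * \<delta> \<le> \<tau> * pass_prob D N l q" using p \<tau> by simp
  also have "\<dots> \<le> (\<Sum>m<D ^ (N + 1). (\<Prod>k<N + 1. l (dig D k m)) * q m)"
    unfolding pass_prob_def sum_distrib_left
  proof (rule sum_mono)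
    fix m assume "m \<in> {..<D ^ (N + 1)}"
    then have qm: "0 \<le> q m" using q by (auto simp: symdist_def)
    have "\<tau> \<le> l (dig D N m)" using \<tau> l0 dig_less_D[of N m] by (cases "dig D N m = 0") auto
    moreover have "0 \<le> (\<Prod>k<N. l (dig D k m)) * q m"
      using qm lpos by (intro mult_nonneg_nonneg prod_nonneg) (auto simp: less_imp_le)
    ultimately have "\<tau> * ((\<Prod>k<N. l (dig D k m)) * q m) \<le> l (dig D N m) * ((\<Prod>k<N. l (dig D k m)) * q m)"
      by (rule mult_right_mono)
    then show "\<tau> * ((\<Prod>k<N. l (dig D k m)) * q m) \<le> (\<Prod>k<N + 1. l (dig D k m)) * q m"
      by (simp add: algebra_simps)
  qed
  finally have "0 \<le> (1 - F) * M * ((\<Sum>m<D ^ (N + 1). (\<Prod>k<N + 1. l (dig D k m)) * q m) - \<tau> * \<delta>)"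
    using M0 F by (intro mult_nonneg_nonneg) auto
  also have "\<dots> \<le> real (N + 1) * (pass_fid D N l q - F * pass_prob D N l q)"
    by (rule gap_lower_bound[where l = l, OF q l0 l \<beta> F h y M N])
  finally have "0 \<le> pass_fid D N l q - F * pass_prob D N l q" by (simp add: zero_le_mult_iff)
  then show ?thesis by simp
qed

text \<open>The mean word weight is at least \<open>f\<close>, so with
  \<open>y = F * \<delta>\<close> the left side of the gap bound dominates
  \<open>(1 - F) * M\<close> times the gap \<open>f - F * p\<close> itself. As \<open>N + 1\<close>
  exceeds that coefficient, the gap cannot be negative.\<close>

lemma fidelity_bound_F:
  fixes l :: "nat \<Rightarrow> real"
  assumes q: "symdist D (N + 1) q" and l0: "l 0 = 1"
    and l: "\<And>a. 0 < a \<Longrightarrow> a < D \<Longrightarrow> 0 < l a \<and> l a \<le> \<beta> \<and> 1 / l a \<le> h * ln (1 / l a)"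
    and \<beta>: "0 < \<beta>" "\<beta> < 1" and F: "0 < F" "F < 1" and h: "0 \<le> h" and \<delta>: "0 < \<delta>" "\<delta> < 1"
    and M: "M = h * F / (1 - F) + 1 / ln (1 / \<beta>)"
    and N: "M * ln (1 / (F * \<delta>)) \<le> real (N + 1)"
    and p: "\<delta> \<le> pass_prob D N l q"
  shows "F * pass_prob D N l q \<le> pass_fid D N l q"
proof -
  have Fd: "F * \<delta> < F" using F \<delta> by simp
  have y: "0 < F * \<delta>" "F * \<delta> < 1" using F \<delta> less_trans[OF Fd F(2)] by auto
  have lpos: "0 < l a" if "a < D" for a using l l0 that by (cases "a = 0") auto
  have M0: "0 < M" unfolding M using \<beta> F h by (intro add_nonneg_pos) auto
  \<comment> \<open>This yields the strict inequality \<open>(1 - F) * M < N + 1\<close> that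
    decides the comparison of the two multiples of the gap.\<close>
  have "1 - F \<le> - ln F" using ln_le_minus_one[OF F(1)] by simp
  also have "\<dots> < ln (1 / (F * \<delta>))" using F \<delta> y by (simp add: ln_div ln_mult)
  finally have "M * (1 - F) < real (N + 1)" using mult_strict_left_mono[OF _ M0] N by fastforce
  then have kappa: "0 < real (N + 1) - (1 - F) * M" by (simp add: mult.commute)
  have "pass_fid D N l q \<le> (\<Sum>m<D ^ (N + 1). (\<Prod>k<N + 1. l (dig D k m)) * q m)"
    unfolding pass_fid_def
  proof (rule sum_mono)
    fix m assume "m \<in> {..<D ^ (N + 1)}"
    then have qm: "0 \<le> q m" using q by (auto simp: symdist_def)
    have "of_bool (dig D N m = 0) \<le> l (dig D N m)"
      using l0 lpos[OF dig_less_D, of N m] by (cases "dig D N m = 0") auto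
    moreover have "0 \<le> (\<Prod>k<N. l (dig D k m)) * q m"
      using qm lpos by (intro mult_nonneg_nonneg prod_nonneg) (auto simp: less_imp_le)
    ultimately have "of_bool (dig D N m = 0) * ((\<Prod>k<N. l (dig D k m)) * q m)
        \<le> l (dig D N m) * ((\<Prod>k<N. l (dig D k m)) * q m)"
      by (rule mult_right_mono)
    then show "(\<Prod>k<N. l (dig D k m)) * of_bool (dig D N m = 0) * q m \<le> (\<Prod>k<N + 1. l (dig D k m)) * q m"
      by (simp add: algebra_simps)
  qed
  moreover have "F * \<delta> \<le> F * pass_prob D N l q" using p F by simp
  ultimately have "pass_fid D N l q - F * pass_prob D N l q
      \<le> (\<Sum>m<D ^ (N + 1). (\<Prod>k<N + 1. l (dig D k m)) * q m) - F * \<delta>" by linarith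
  then have "(1 - F) * M * (pass_fid D N l q - F * pass_prob D N l q)
      \<le> (1 - F) * M * ((\<Sum>m<D ^ (N + 1). (\<Prod>k<N + 1. l (dig D k m)) * q m) - F * \<delta>)"
    by (rule mult_left_mono) (use M0 F in simp)
  also have "\<dots> \<le> real (N + 1) * (pass_fid D N l q - F * pass_prob D N l q)"
    by (rule gap_lower_bound[where l = l, OF q l0 l \<beta> F h y M N])
  finally have "0 \<le> (real (N + 1) - (1 - F) * M) * (pass_fid D N l q - F * pass_prob D N l q)"
    by (simp add: left_diff_distrib)
  then show ?thesis using kappa by (simp add: zero_le_mult_iff)
qed

section \<open>Reduction to homogeneous operators\<close>

definition collapse :: "nat \<Rightarrow> nat \<Rightarrow> nat \<Rightarrow> nat" where
  "collapse n j m = undig D n (\<lambda>k. if dig D k m = 0 then 0 else j)"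

text \<open>Collapsing acts letter by letter and hence commutes with permuting positions, so the
  image distribution is again symmetric. The second property is the change of variables.\<close>

lemma collapse_pushforward:
  assumes q: "symdist D n q" and j: "j < D"
  obtains q' where "symdist D n q'"
    and "\<And>\<phi>. (\<Sum>m<D ^ n. \<phi> m * q' m) = (\<Sum>m<D ^ n. \<phi> (collapse n j m) * q m)"
proof -
  define q' where "q' m = (\<Sum>m'<D ^ n. of_bool (collapse n j m' = m) * q m')" for m
  have less: "collapse n j m < D ^ n" for m
    unfolding collapse_def using j D_pos by (intro undig_less) auto
  have dig: "dig D k (collapse n j m) = (if dig D k m = 0 then 0 else j)" if "k < n" for k m
    unfolding collapse_def using j D_pos that by (intro dig_undig) auto
  have push: "(\<Sum>m<D ^ n. \<phi> m * q' m) = (\<Sum>m<D ^ n. \<phi> (collapse n j m) * q m)" for \<phi> :: "nat \<Rightarrow> real"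
  proof -
    have "(\<Sum>m<D ^ n. \<phi> m * q' m)
        = (\<Sum>m<D ^ n. \<Sum>m'<D ^ n. \<phi> m * (of_bool (collapse n j m' = m) * q m'))"
      by (simp only: q'_def sum_distrib_left)
    also have "\<dots> = (\<Sum>m'<D ^ n. \<Sum>m<D ^ n. \<phi> m * (of_bool (collapse n j m' = m) * q m'))"
      by (rule sum.swap)
    also have "\<dots> = (\<Sum>m'<D ^ n. \<Sum>m<D ^ n. if m = collapse n j m' then \<phi> m * q m' else 0)"
      by (intro sum.cong) auto
    also have "\<dots> = (\<Sum>m'<D ^ n. \<phi> (collapse n j m') * q m')" using less by simp
    finally show ?thesis .
  qed
  have "symdist D n q'"
    unfolding symdist_def
  proof (intro conjI allI impI)
    show "0 \<le> q' m" for m using q unfolding q'_def by (intro sum_nonneg) (auto simp: symdist_def)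
    show "(\<Sum>m<D ^ n. q' m) = 1" using push[of "\<lambda>_. 1"] q by (simp add: symdist_def)
    fix \<sigma> m assume \<sigma>: "\<sigma> permutes {..<n}" and m: "m < D ^ n"
    let ?p = "perm_index D n \<sigma>"
    have comm: "collapse n j (?p m') = ?p (collapse n j m')" for m'
    proof (rule dig_eqI)
      fix k assume k: "k < n"
      then have "\<sigma> k < n" using permutes_in_image[OF \<sigma>, of k] by auto
      then show "dig D k (collapse n j (?p m')) = dig D k (?p (collapse n j m'))"
        using k by (simp add: dig dig_perm_index D_pos)
    qed (auto simp: less perm_index_less D_pos)
    have inj: "?p a = ?p b \<longleftrightarrow> a = b" if "a < D ^ n" "b < D ^ n" for a b
      using perm_index_inv[OF D_pos permutes_inv[OF \<sigma>] \<sigma>] permutes_inverses[OF \<sigma>] that by metis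
    have "q' (?p m) = (\<Sum>m'<D ^ n. of_bool (collapse n j (?p m') = ?p m) * q (?p m'))"
      unfolding q'_def by (rule sum_perm_index[OF D_pos \<sigma>, symmetric])
    also have "\<dots> = q' m"
      unfolding q'_def using q \<sigma> m
      by (intro sum.cong refl) (auto simp: comm inj[OF less m] symdist_def)
    finally show "q' (?p m) = q' m" .
  qed
  then show ?thesis using that push by blast
qed

text \<open>The collapsed distribution has under \<open>l\<close> the same \<open>p\<close> and
  \<open>f\<close> as \<open>q\<close> has under the homogeneous eigenvalues;
  \<open>j \<noteq> 0\<close> ensures that bad letters stay bad. Each homogeneous test case is thus
  one for \<open>l\<close>.\<close>

lemma condition_hom_if_condition:
  fixes l :: "nat \<Rightarrow> real"
  assumes l0: "l 0 = 1" and j: "0 < j" "j < D"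
    and cond: "\<And>q. symdist D (N + 1) q \<Longrightarrow> \<delta> \<le> pass_prob D N l q \<Longrightarrow> F * pass_prob D N l q \<le> pass_fid D N l q"
    and q: "symdist D (N + 1) q" and p: "\<delta> \<le> pass_prob D N (\<lambda>a. if a = 0 then 1 else l j) q"
  shows "F * pass_prob D N (\<lambda>a. if a = 0 then 1 else l j) q \<le> pass_fid D N (\<lambda>a. if a = 0 then 1 else l j) q"
proof -
  from collapse_pushforward[OF q j(2)] obtain q' where q': "symdist D (N + 1) q'"
    and push: "\<And>\<phi>. (\<Sum>m<D ^ (N + 1). \<phi> m * q' m) = (\<Sum>m<D ^ (N + 1). \<phi> (collapse (N + 1) j m) * q m)"
    by blast
  have dig: "dig D k (collapse (N + 1) j m) = (if dig D k m = 0 then 0 else j)" if "k < N + 1" for k m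
    unfolding collapse_def using j D_pos that by (intro dig_undig) auto
  have ldig: "l (dig D k (collapse (N + 1) j m)) = (if dig D k m = 0 then 1 else l j)"
    if "k < N" for k m using dig[of k m] that l0 by simp
  have prod: "(\<Prod>k<N. l (dig D k (collapse (N + 1) j m))) = (\<Prod>k<N. if dig D k m = 0 then 1 else l j)" for m
    by (intro prod.cong refl ldig) auto
  have zero: "dig D N (collapse (N + 1) j m) = 0 \<longleftrightarrow> dig D N m = 0" for m
    using dig[of N m] j by simp
  have "pass_prob D N l q' = pass_prob D N (\<lambda>a. if a = 0 then 1 else l j) q"
    unfolding pass_prob_def push prod ..
  moreover have "pass_fid D N l q' = pass_fid D N (\<lambda>a. if a = 0 then 1 else l j) q"
    unfolding pass_fid_def push prod zero ..
  ultimately show ?thesis using cond[OF q'] p by simp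
qed

section \<open>Hamming weight and test distributions for homogeneous operators\<close>

definition weight :: "nat \<Rightarrow> nat \<Rightarrow> nat" where
  "weight n m = (\<Sum>k<n. of_bool (dig D k m \<noteq> 0))"

definition uniform_weight :: "nat \<Rightarrow> nat \<Rightarrow> nat \<Rightarrow> real" where
  "uniform_weight n z m = of_bool (weight n m = z) / real (card {m. m < D ^ n \<and> weight n m = z})"

lemma symdist_uniform_weight:
  assumes z: "z \<le> n"
  shows "symdist D n (uniform_weight n z)"
  unfolding symdist_def
proof (intro conjI allI impI)
  let ?S = "{m. m < D ^ n \<and> weight n m = z}"
  \<comment> \<open>The word with letter 1 in the first \<open>z\<close> positions shows that the
    normalising cardinality is nonzero.\<close>
  define m0 where "m0 = undig D n (\<lambda>k. of_bool (k < z))"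
  have "m0 < D ^ n" unfolding m0_def using D_ge_2 by (intro undig_less) auto
  moreover have "weight n m0 = z"
  proof -
    have "dig D k m0 = of_bool (k < z)" if "k < n" for k
      unfolding m0_def using D_ge_2 that by (intro dig_undig) auto
    then have "weight n m0 = (\<Sum>k<n. of_bool (k < z))"
      unfolding weight_def by (intro sum.cong) auto
    also have "\<dots> = card ({..<n} \<inter> {k. k < z})" by (simp add: of_bool_def sum.If_cases)
    also have "{..<n} \<inter> {k. k < z} = {..<z}" using z by auto
    finally show ?thesis by simp
  qed
  ultimately have "m0 \<in> ?S" by simp
  then have card: "card ?S \<noteq> 0" by (auto simp: card_eq_0_iff)
  have "(\<Sum>m<D ^ n. of_bool (weight n m = z)) = real (card ({..<D ^ n} \<inter> {m. weight n m = z}))"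
    by (simp add: of_bool_def sum.If_cases)
  also have "{..<D ^ n} \<inter> {m. weight n m = z} = ?S" by auto
  finally show "(\<Sum>m<D ^ n. uniform_weight n z m) = 1"
    using card unfolding uniform_weight_def by (simp flip: sum_divide_distrib)
  fix \<sigma> m assume \<sigma>: "\<sigma> permutes {..<n}"
  have "weight n (perm_index D n \<sigma> m) = (\<Sum>k<n. of_bool (dig D (\<sigma> k) m \<noteq> 0))"
    unfolding weight_def by (intro sum.cong) (auto simp: dig_perm_index D_pos)
  also have "\<dots> = weight n m"
    unfolding weight_def using sum.permute[OF \<sigma>, of "\<lambda>k. of_bool (dig D k m \<noteq> 0) :: nat"]
    by (simp only: o_def)
  finally show "uniform_weight n z (perm_index D n \<sigma> m) = uniform_weight n z m"
    by (simp add: uniform_weight_def)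
qed (simp add: uniform_weight_def)

text \<open>After symmetrisation the summands depend on a word only through its Hamming weight,
  which is constantly \<open>z\<close> on the support.\<close>

lemma pass_prob_fid_uniform_weight:
  assumes z: "z \<le> N + 1" and r: "0 < r"
  defines "l \<equiv> \<lambda>a. if a = 0 then 1 else r"
  shows "real (N + 1) * pass_prob D N l (uniform_weight (N + 1) z) = r ^ z * (real (N + 1) - real z + real z / r)"
    and "real (N + 1) * pass_fid D N l (uniform_weight (N + 1) z) = r ^ z * (real (N + 1) - real z)"
proof -
  let ?q = "uniform_weight (N + 1) z"
  have lpos: "0 < l a" for a using r by (simp add: l_def)
  note sd = symdist_uniform_weight[OF z]
  have q1: "(\<Sum>m<D ^ (N + 1). ?q m) = 1" using sd by (simp add: symdist_def)
  have w: "(\<Prod>k<N + 1. l (dig D k m)) = r ^ weight (N + 1) m" for m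
    unfolding weight_def power_sum by (intro prod.cong) (auto simp: l_def)
  have wr: "real (weight (N + 1) m) = (\<Sum>k<N + 1. of_bool (dig D k m \<noteq> 0))" for m
    unfolding weight_def of_nat_sum by (intro sum.cong) auto
  have f: "(\<Sum>j<N + 1. of_bool (dig D j m = 0) / l (dig D j m)) = real (N + 1) - real (weight (N + 1) m)" for m
  proof -
    have "(\<Sum>j<N + 1. of_bool (dig D j m = 0) / l (dig D j m))
        = (\<Sum>j<N + 1. 1 - of_bool (dig D j m \<noteq> 0))"
      by (intro sum.cong) (auto simp: l_def)
    then show ?thesis unfolding wr by (simp only: sum_subtractf sum_constant card_lessThan) simp
  qed
  have p: "(\<Sum>j<N + 1. 1 / l (dig D j m))
      = real (N + 1) - real (weight (N + 1) m) + real (weight (N + 1) m) / r" for m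
  proof -
    have "(\<Sum>j<N + 1. 1 / l (dig D j m))
        = (\<Sum>j<N + 1. (1 - of_bool (dig D j m \<noteq> 0)) + of_bool (dig D j m \<noteq> 0) / r)"
      by (intro sum.cong) (auto simp: l_def)
    then show ?thesis unfolding wr
      by (simp only: sum.distrib sum_subtractf sum_constant card_lessThan sum_divide_distrib) simp
  qed
  have sup: "G (weight (N + 1) m) * ?q m = G z * ?q m" for G :: "nat \<Rightarrow> real" and m
    by (cases "weight (N + 1) m = z") (auto simp: uniform_weight_def)
  have "real (N + 1) * pass_prob D N l ?q
      = (\<Sum>m<D ^ (N + 1). (\<lambda>z. r ^ z * (real (N + 1) - real z + real z / r)) (weight (N + 1) m) * ?q m)"
    unfolding pass_prob_symmetrize[OF lpos sd] w p ..
  also have "\<dots> = (\<Sum>m<D ^ (N + 1). r ^ z * (real (N + 1) - real z + real z / r) * ?q m)"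
    by (intro sum.cong refl sup)
  also have "\<dots> = r ^ z * (real (N + 1) - real z + real z / r)"
    by (simp only: q1 mult_1_right flip: sum_distrib_left)
  finally show "real (N + 1) * pass_prob D N l ?q = r ^ z * (real (N + 1) - real z + real z / r)" .
  have "real (N + 1) * pass_fid D N l ?q
      = (\<Sum>m<D ^ (N + 1). (\<lambda>z. r ^ z * (real (N + 1) - real z)) (weight (N + 1) m) * ?q m)"
    unfolding pass_fid_symmetrize[OF lpos sd] w f ..
  also have "\<dots> = (\<Sum>m<D ^ (N + 1). r ^ z * (real (N + 1) - real z) * ?q m)"
    by (intro sum.cong refl sup)
  also have "\<dots> = r ^ z * (real (N + 1) - real z)"
    by (simp only: q1 mult_1_right flip: sum_distrib_left)
  finally show "real (N + 1) * pass_fid D N l ?q = r ^ z * (real (N + 1) - real z)" .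
qed

lemma symdist_mix:
  assumes "symdist D n q" "symdist D n q'" "0 \<le> a" "0 \<le> b" "a + b = 1"
  shows "symdist D n (\<lambda>m. a * q m + b * q' m)"
  using assms by (auto simp: symdist_def sum.distrib simp flip: sum_distrib_left)

lemma pass_prob_fid_mix:
  "pass_prob D N l (\<lambda>m. a * q m + b * q' m) = a * pass_prob D N l q + b * pass_prob D N l q'"
  "pass_fid D N l (\<lambda>m. a * q m + b * q' m) = a * pass_fid D N l q + b * pass_fid D N l q'"
  unfolding pass_prob_def pass_fid_def sum_distrib_left sum.distrib[symmetric]
  by (intro sum.cong refl; simp add: algebra_simps)+

text \<open>The condition is tested on explicit distributions: the all-bad words force
  \<open>k \<le> N\<close>, then a mixture of two neighbouring Hamming weights gives the
  quantitative bound.\<close>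

lemma hom_lower_bound:
  fixes r F \<delta> :: real
  defines "l \<equiv> \<lambda>a::nat. if a = 0 then 1 else r"
  assumes cond: "\<And>q. symdist D (N + 1) q \<Longrightarrow> \<delta> \<le> pass_prob D N l q \<Longrightarrow> F * pass_prob D N l q \<le> pass_fid D N l q"
    and r: "0 < r" "r < 1" and F: "0 < F" and \<delta>: "0 < \<delta>" "\<delta> \<le> r ^ k" and k: "1 \<le> k"
  shows "k \<le> N" and "real k * F \<le> (1 - F) * r * (real N - real k)"
proof -
  show kN: "k \<le> N"
  proof (rule ccontr)
    assume "\<not> k \<le> N"
    then have "r ^ k \<le> r ^ N" using r by (intro power_decreasing) auto
    with \<delta>(2) have "\<delta> \<le> r ^ N" by (rule order_trans)
    \<comment> \<open>With all letters bad, the acceptance probability is \<open>r ^ N\<close>,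
      still at least \<delta>, while the fidelity vanishes.\<close>
    let ?q = "uniform_weight (N + 1) (N + 1)"
    have "real (N + 1) * pass_prob D N l ?q = real (N + 1) * r ^ N"
      unfolding l_def pass_prob_fid_uniform_weight(1)[OF order_refl r(1)] using r by simp
    then have p: "pass_prob D N l ?q = r ^ N" by simp
    have "real (N + 1) * pass_fid D N l ?q = 0"
      unfolding l_def pass_prob_fid_uniform_weight(2)[OF order_refl r(1)] by simp
    then have f: "pass_fid D N l ?q = 0" by simp
    have "F * r ^ N \<le> 0"
      using cond[OF symdist_uniform_weight[OF order_refl]] p f \<open>\<delta> \<le> r ^ N\<close> by simp
    moreover have "0 < F * r ^ N" using F r by simp
    ultimately show False by simp
  qed
  define n where "n = N - k"
  have N: "N = n + k" using kN by (simp add: n_def)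
  \<comment> \<open>Since \<open>n\<close> may be 0, positivity rests on
    \<open>k \<ge> 1\<close>.\<close>
  have s: "0 < r * n + k" using r k by (simp add: add_nonneg_pos)
  let ?q = "uniform_weight (N + 1) k" and ?q' = "uniform_weight (N + 1) (k + 1)"
  \<comment> \<open>The proportion \<open>r * n : k\<close> makes the acceptance probability exactly
    \<open>r ^ k\<close>, because \<open>r * n * (n + 1 + k / r) + k * (r * n + k + 1) = (r * n + k)
    * (n + k + 1)\<close>.\<close>
  define a where "a = r * n / (r * n + k)"
  define b where "b = k / (r * n + k)"
  have "a + b = 1" using s by (simp add: a_def b_def flip: add_divide_distrib)
  moreover have "0 \<le> a" "0 \<le> b" using r s by (auto simp: a_def b_def)
  ultimately have sd: "symdist D (N + 1) (\<lambda>m. a * ?q m + b * ?q' m)"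
    using kN by (intro symdist_mix symdist_uniform_weight) auto
  have p1: "real (N + 1) * pass_prob D N l ?q = r ^ k * (real n + 1 + real k / r)"
    and f1: "real (N + 1) * pass_fid D N l ?q = r ^ k * (real n + 1)"
    using pass_prob_fid_uniform_weight[of k N r] r N unfolding l_def by (simp_all add: algebra_simps)
  have p2: "real (N + 1) * pass_prob D N l ?q' = r ^ k * (r * real n + real k + 1)"
    and f2: "real (N + 1) * pass_fid D N l ?q' = r ^ k * (r * real n)"
  proof -
    have "r ^ (k + 1) * (real (N + 1) - real (k + 1) + real (k + 1) / r) = r ^ k * (r * real n + real k + 1)"
      "r ^ (k + 1) * (real (N + 1) - real (k + 1)) = r ^ k * (r * real n)"
      using r N by (simp_all add: field_simps)
    then show "real (N + 1) * pass_prob D N l ?q' = r ^ k * (r * real n + real k + 1)"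
      "real (N + 1) * pass_fid D N l ?q' = r ^ k * (r * real n)"
      using pass_prob_fid_uniform_weight[of "k + 1" N r] r kN unfolding l_def by simp_all
  qed
  have "real (N + 1) * pass_prob D N l (\<lambda>m. a * ?q m + b * ?q' m)
      = a * (real (N + 1) * pass_prob D N l ?q) + b * (real (N + 1) * pass_prob D N l ?q')"
    unfolding pass_prob_fid_mix by (simp add: algebra_simps)
  also have "\<dots> = real (N + 1) * r ^ k"
  proof -
    have "(r * n + k) * (a * (r ^ k * (real n + 1 + real k / r)) + b * (r ^ k * (r * real n + real k + 1)))
        = ((r * n + k) * a) * (r ^ k * (real n + 1 + real k / r))
          + ((r * n + k) * b) * (r ^ k * (r * real n + real k + 1))" by (simp only: algebra_simps)
    also have "\<dots> = (r * n) * (r ^ k * (real n + 1 + real k / r)) + k * (r ^ k * (r * real n + real k + 1))"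
      using s by (simp add: a_def b_def)
    also have "\<dots> = (r * n + k) * (real (N + 1) * r ^ k)"
      using r unfolding N by (simp add: field_simps)
    finally show ?thesis unfolding p1 p2 using s by simp
  qed
  finally have p: "pass_prob D N l (\<lambda>m. a * ?q m + b * ?q' m) = r ^ k" by simp
  have "real (N + 1) * pass_fid D N l (\<lambda>m. a * ?q m + b * ?q' m)
      = a * (real (N + 1) * pass_fid D N l ?q) + b * (real (N + 1) * pass_fid D N l ?q')"
    unfolding pass_prob_fid_mix by (simp add: algebra_simps)
  also have "\<dots> = real (N + 1) * (r ^ k * a)"
  proof -
    \<comment> \<open>This turns the contribution of the heavier words into a multiple of
      \<open>a\<close>, so the two contributions add up to \<open>a * (n + 1 + k)\<close> times
      \<open>r ^ k\<close>.\<close>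
    have "b * (r * n) = a * k" by (simp add: a_def b_def)
    then have "b * (r ^ k * (r * n)) = r ^ k * (a * k)" by (simp add: mult.left_commute)
    then show ?thesis unfolding f1 f2 by (simp add: N algebra_simps)
  qed
  finally have f: "pass_fid D N l (\<lambda>m. a * ?q m + b * ?q' m) = r ^ k * a" by simp
  have "F * r ^ k \<le> r ^ k * a" using cond[OF sd] unfolding p f using \<delta> by simp
  then have "F \<le> a" using r by (simp add: mult.commute)
  then have "F * (r * n + k) \<le> r * n" using s by (simp add: a_def pos_le_divide_eq)
  then show "real k * F \<le> (1 - F) * r * (real N - real k)" unfolding N by (simp add: algebra_simps)
qed

end

section \<open>Number of tests\<close>

text \<open>A concave function on an interval is smallest at an endpoint. The tangent at
  \<open>x\<close> has slope \<open>- (1 + ln x)\<close>, and its sign decides which endpoint to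
  compare with.\<close>

lemma min_entropy_le:
  fixes \<tau> x \<beta> :: real
  assumes "0 < \<tau>" "\<tau> \<le> x" "x \<le> \<beta>"
  shows "min (\<beta> * ln (1 / \<beta>)) (\<tau> * ln (1 / \<tau>)) \<le> x * ln (1 / x)"
proof -
  have tangent: "(w - x) * (1 + ln x) \<le> x * ln (1 / x) - w * ln (1 / w)" if "0 < w" for w
  proof -
    have "w - x \<le> w * (ln w - ln x)" using assms that by (intro mult_add_ln_ge) auto
    then show ?thesis using assms that by (simp add: ln_div algebra_simps)
  qed
  show ?thesis
  proof (cases "0 \<le> 1 + ln x")
    case True
    then have "0 \<le> (\<beta> - x) * (1 + ln x)" using assms by simp
    with tangent[of \<beta>] assms show ?thesis by simp
  next
    case False
    then have "0 \<le> (\<tau> - x) * (1 + ln x)" using assms by (intro mult_nonpos_nonpos) auto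
    with tangent[of \<tau>] assms show ?thesis by simp
  qed
qed

text \<open>Ensures that the first upper bound is an admissible number of tests, that is, at least
  1. One of the two summands alone reaches 1 already with \<open>ln (1 / F)\<close>;
  \<open>\<delta> < 1\<close> gives strictness.\<close>

lemma fidelity_test_count_gt_1:
  fixes \<beta> F \<delta> h :: real
  assumes \<beta>: "0 < \<beta>" "\<beta> < 1" and F: "0 < F" "F < 1" and \<delta>: "0 < \<delta>" "\<delta> < 1"
    and h: "1 \<le> h * (\<beta> * ln (1 / \<beta>))"
  shows "1 < (h * F / (1 - F) + 1 / ln (1 / \<beta>)) * ln (1 / (F * \<delta>))"
proof -
  define b where "b = ln (1 / \<beta>)"
  define s where "s = ln (1 / F)"
  have b: "0 < b" and s: "0 < s" using \<beta> F by (auto simp: b_def s_def)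
  have b': "b = - ln \<beta>" and s': "s = - ln F" using \<beta> F by (auto simp: b_def s_def ln_div)
  have "0 < \<beta> * ln (1 / \<beta>)" "0 < h * (\<beta> * ln (1 / \<beta>))" using h \<beta> b b_def by (simp, linarith)
  then have h0: "0 < h" by (metis zero_less_mult_pos2)
  have M0: "0 < h * F / (1 - F) + 1 / b" using h0 F b by (intro add_nonneg_pos) auto
  have "1 \<le> (h * F / (1 - F) + 1 / b) * s"
  proof (cases "F \<le> \<beta>")
    case True
    then have "b \<le> s" unfolding b_def s_def using F by (simp add: frac_le)
    then have "1 \<le> 1 / b * s" using b by simp
    moreover have "0 \<le> h * F / (1 - F) * s" using h0 F s by simp
    ultimately show ?thesis by (simp only: distrib_right)
  next
    case False
    have "\<beta> - F \<le> \<beta> * (ln \<beta> - ln F)" "1 - F \<le> 1 * (ln 1 - ln F)"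
      using \<beta> F by (intro mult_add_ln_ge; simp)+
    then have 1: "\<beta> - F \<le> \<beta> * (s - b)" and 2: "1 - F \<le> s" by (simp_all add: b' s')
    \<comment> \<open>Up to the factor \<open>1 - \<beta>\<close>, the weights \<open>1 - F\<close>
      and \<open>F - \<beta>\<close> write \<open>F\<close> as a convex combination of \<beta> and
      1, so the left side is 0. The outcome is concavity of \<open>x * ln (1 / x)\<close> along the
      chord from \<beta> to 1.\<close>
    have "(1 - F) * (\<beta> - F) + (F - \<beta>) * (1 - F) \<le> (1 - F) * (\<beta> * (s - b)) + (F - \<beta>) * s"
      using 1 2 F False by (intro add_mono mult_left_mono) auto
    then have "(1 - F) * (\<beta> * b) \<le> F * s * (1 - \<beta>)" by (simp add: algebra_simps)
    also have "\<dots> \<le> F * s * 1" using F s \<beta> by (intro mult_left_mono) auto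
    finally have "\<beta> * b \<le> F * s / (1 - F)" using F by (simp add: pos_le_divide_eq mult.commute)
    then have "h * (\<beta> * b) \<le> h * (F * s / (1 - F))" using h0 by (intro mult_left_mono) auto
    with h have "1 \<le> h * F / (1 - F) * s" by (simp add: b_def)
    moreover have "0 \<le> 1 / b * s" using b s by simp
    ultimately show ?thesis by (simp only: distrib_right)
  qed
  also have "\<dots> < (h * F / (1 - F) + 1 / b) * ln (1 / (F * \<delta>))"
    using M0 F \<delta> by (intro mult_strict_left_mono) (auto simp: s_def ln_div ln_mult)
  finally show ?thesis unfolding b_def .
qed

text \<open>As \<open>ln r\<close> is negative, rounding the quotient down makes the power of
  \<open>r\<close> larger.\<close>

lemma le_power_kminus:
  assumes "0 < \<delta>" "\<delta> < 1" "0 < r" "r < 1"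
  shows "0 \<le> kminus \<delta> r" "\<delta> \<le> r ^ nat (kminus \<delta> r)"
proof -
  have "0 < ln \<delta> / ln r" using assms by (simp add: divide_neg_neg)
  then show k: "0 \<le> kminus \<delta> r" by (simp add: kminus_def)
  have "real (nat (kminus \<delta> r)) \<le> ln \<delta> / ln r" using k by (simp add: kminus_def)
  then have "ln \<delta> \<le> real (nat (kminus \<delta> r)) * ln r" using assms by (simp add: neg_le_divide_eq)
  then have "ln \<delta> \<le> ln (r ^ nat (kminus \<delta> r))" using assms by (simp add: ln_realpow)
  then show "\<delta> \<le> r ^ nat (kminus \<delta> r)" using assms by (simp add: ln_le_cancel_iff)
qed

context eigenbasis
begin

text \<open>Formulated for every \<open>N\<close> that reaches the target fidelity, hence applicable
  to the least one.\<close>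

lemma Nver_hom_op_ge:
  assumes F: "0 < \<epsilon>" "\<epsilon> < 1" and \<delta>: "0 < \<delta>" "\<delta> < 1" and r: "0 < r" "r < 1"
    and N: "1 - \<epsilon> \<le> Fmin D \<Psi> N \<delta> (hom_op D \<Psi> r)"
  shows "kminus \<delta> r + \<lceil>real_of_int (kminus \<delta> r) * (1 - \<epsilon>) / (r * \<epsilon>)\<rceil> \<le> int N"
\<comment> \<open>If \<open>kminus \<delta> r\<close> is 0 the bound is 0; the mixture construction
  needs \<open>k \<ge> 1\<close>.\<close>
proof (cases "kminus \<delta> r = 0")
  case False
  define k where "k = nat (kminus \<delta> r)"
  have k: "kminus \<delta> r = int k" and k1: "1 \<le> k" and dk: "\<delta> \<le> r ^ k"
    using le_power_kminus[OF \<delta> r] False by (auto simp: k_def)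
  have F': "0 < 1 - \<epsilon>" using F by simp
  have cond: "(1 - \<epsilon>) * pass_prob D N (\<lambda>a. if a = 0 then 1 else r) q \<le> pass_fid D N (\<lambda>a. if a = 0 then 1 else r) q"
    if "symdist D (N + 1) q" "\<delta> \<le> pass_prob D N (\<lambda>a. if a = 0 then 1 else r) q" for q
    using Fmin_ge_iff[OF spectral_hom_op[of r], of \<delta> "1 - \<epsilon>" N] N that r \<delta> by auto
  note hlb = hom_lower_bound[OF cond r F' \<delta>(1) dk k1]
  have "real k * (1 - \<epsilon>) \<le> (real N - real k) * (r * \<epsilon>)"
    using hlb(2) by (simp add: algebra_simps)
  then have "real k * (1 - \<epsilon>) / (r * \<epsilon>) \<le> real N - real k"
    using r F by (intro pos_divide_le_eq[THEN iffD2]) auto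
  \<comment> \<open>The difference of \<open>N\<close> and \<open>k\<close> is an integer, so the
    real bound may be rounded up.\<close>
  then have "\<lceil>real k * (1 - \<epsilon>) / (r * \<epsilon>)\<rceil> \<le> int N - int k" by (simp add: ceiling_le_iff)
  then show ?thesis by (simp add: k)
qed simp

end

theorem theorem6:
  fixes D :: nat and \<Psi> :: "complex vec" and Om :: "complex mat" and lam :: "nat \<Rightarrow> real"
    and \<epsilon> \<delta> :: real
  assumes D2: "D \<ge> 2"
    and eps: "0 < \<epsilon>" "\<epsilon> < 1"
    and del: "0 < \<delta>" "\<delta> < 1"
    and ver: "verification_op D \<Psi> Om"
    and posdef: "pd D Om"
    and eigs: "char_poly Om = (\<Prod>j\<in>{1..D}. [:- complex_of_real (lam j), 1:])"
    and lam1: "lam 1 = 1" and lam2: "lam 2 < 1"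
    and lam_mono: "\<forall>j\<in>{2..<D}. lam (j + 1) \<le> lam j"
    and lamD: "lam D > 0"
  defines "\<beta> \<equiv> lam 2"
    and "\<tau> \<equiv> lam D"
    and "F \<equiv> 1 - \<epsilon>"
    and "h \<equiv> 1 / min (lam 2 * ln (1 / lam 2)) (lam D * ln (1 / lam D))"
    and "\<beta>t \<equiv> (if lam 2 * ln (1 / lam 2) \<le> lam D * ln (1 / lam D) then lam 2 else lam D)"
    and "NN \<equiv> Nver D \<Psi> \<epsilon> \<delta> Om"
  shows "(\<forall>j\<in>{2..D}.
            NN \<ge> Nver D \<Psi> \<epsilon> \<delta> (hom_op D \<Psi> (lam j)) \<and>
            int (Nver D \<Psi> \<epsilon> \<delta> (hom_op D \<Psi> (lam j)))
              \<ge> kminus \<delta> (lam j) + \<lceil>real_of_int (kminus \<delta> (lam j)) * F / (lam j * \<epsilon>)\<rceil>)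
    \<and> kminus \<delta> \<beta>t + \<lceil>real_of_int (kminus \<delta> \<beta>t) * F / (\<beta>t * \<epsilon>)\<rceil> \<le> int NN
    \<and> int NN \<le> \<lceil>h * F * ln (1 / (F * \<delta>)) / \<epsilon> + ln (F * \<delta>) / ln \<beta> - 1\<rceil>
    \<and> real_of_int \<lceil>h * F * ln (1 / (F * \<delta>)) / \<epsilon> + ln (F * \<delta>) / ln \<beta> - 1\<rceil>
        < h * ln (1 / (F * \<delta>)) / \<epsilon>
    \<and> int NN \<le> \<lceil>h * F * ln (1 / (\<tau> * \<delta>)) / \<epsilon> + ln (\<tau> * \<delta>) / ln \<beta> - 1\<rceil>
    \<and> real_of_int \<lceil>h * F * ln (1 / (\<tau> * \<delta>)) / \<epsilon> + ln (\<tau> * \<delta>) / ln \<beta> - 1\<rceil>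
        < h * ln (1 / (\<tau> * \<delta>)) / \<epsilon>"
proof -
  have F: "0 < F" "F < 1" and eF: "1 - F = \<epsilon>" using eps by (auto simp: F_def)
  have unit: "unit_vector D \<Psi>" and herm: "hermitian_mat D Om"
    and nondeg: "\<And>v. v \<in> carrier_vec D \<Longrightarrow> Om *\<^sub>v v = v \<Longrightarrow> \<exists>c. v = c \<cdot>\<^sub>v \<Psi>"
    using ver by (auto simp: verification_op_def psd_def)
  have Om: "Om \<in> carrier_mat D D" using herm by (simp add: hermitian_mat_def)
  have \<Psi>: "\<Psi> \<in> carrier_vec D" and norm: "(\<Sum>x<D. (cmod (\<Psi> $ x))\<^sup>2) = 1"
    using unit by (auto simp: unit_vector_def)
  obtain u :: "nat \<Rightarrow> nat \<Rightarrow> complex"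
    where orth: "\<And>a b. a < D \<Longrightarrow> b < D \<Longrightarrow> (\<Sum>x<D. cnj (u a x) * u b x) = of_bool (a = b)"
    and compl: "\<And>x y. x < D \<Longrightarrow> y < D \<Longrightarrow> (\<Sum>a<D. u a x * cnj (u a y)) = of_bool (x = y)"
    and spec: "\<And>x y. x < D \<Longrightarrow> y < D \<Longrightarrow>
      Om $$ (x, y) = (\<Sum>a<D. of_real (lam (Suc a)) * (u a x * cnj (u a y)))"
    using hermitian_eigenbasis[OF herm eigs] by blast
  have D0: "0 < D" using D2 by simp
  \<comment> \<open>By nondegeneracy the eigenvector for \<open>lam 1 = 1\<close> is a multiple of
    \<Psi>; comparing norms makes the multiplier a phase, so the projections agree.\<close>
  define v where "v = vec D (u 0)"
  have v: "v \<in> carrier_vec D" by (simp add: v_def)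
  have "Om *\<^sub>v v = v"
  proof (rule eq_vecI)
    fix x assume "x < dim_vec v"
    then have x: "x < D" by (simp add: v_def)
    have "(Om *\<^sub>v v) $ x = (\<Sum>y<D. Om $$ (x, y) * u 0 y)"
      using Om x by (auto simp: v_def scalar_prod_def lessThan_atLeast0 intro!: sum.cong)
    also have "\<dots> = (\<Sum>y<D. \<Sum>a<D. of_real (lam (Suc a)) * u a x * (cnj (u a y) * u 0 y))"
      using x by (intro sum.cong refl) (simp add: spec sum_distrib_right mult.assoc)
    also have "\<dots> = (\<Sum>a<D. of_real (lam (Suc a)) * u a x * (\<Sum>y<D. cnj (u a y) * u 0 y))"
      by (subst sum.swap) (simp add: sum_distrib_left)
    also have "\<dots> = (\<Sum>a<D. if a = 0 then u 0 x else 0)"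
      using D0 lam1 by (intro sum.cong refl) (auto simp: orth)
    finally show "(Om *\<^sub>v v) $ x = v $ x" using D0 x by (simp add: v_def)
  qed (use Om in \<open>auto simp: v_def\<close>)
  from nondeg[OF v this] obtain c where c: "v = c \<cdot>\<^sub>v \<Psi>" by blast
  have uc: "u 0 x = c * \<Psi> $ x" if "x < D" for x
  proof -
    have "u 0 x = v $ x" using that by (simp add: v_def)
    then show ?thesis using c \<Psi> that by simp
  qed
  have cc: "c * cnj c = 1"
  proof -
    have "1 = (\<Sum>x<D. cnj (u 0 x) * u 0 x)" using orth[OF D0 D0] by simp
    also have "\<dots> = (\<Sum>x<D. c * cnj c * of_real ((cmod (\<Psi> $ x))\<^sup>2))"
      by (intro sum.cong refl) (simp add: uc complex_norm_square del: of_real_power)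
    also have "\<dots> = c * cnj c * of_real (\<Sum>x<D. (cmod (\<Psi> $ x))\<^sup>2)"
      by (simp add: sum_distrib_left)
    finally show ?thesis unfolding norm by simp
  qed
  have target: "\<Psi> $ x * cnj (\<Psi> $ y) = u 0 x * cnj (u 0 y)" if "x < D" "y < D" for x y
  proof -
    have "u 0 x * cnj (u 0 y) = (c * cnj c) * (\<Psi> $ x * cnj (\<Psi> $ y))"
      using that by (simp add: uc)
    then show ?thesis by (simp add: cc)
  qed
  interpret eigenbasis D \<Psi> u
    using D2 orth compl target by unfold_locales auto

  \<comment> \<open>Range of the eigenvalues and the constants \<open>h\<close> and
    \<open>M\<close>\<close>
  define l where "l a = lam (Suc a)" for a
  have spectral: "spectral Om l" using spec by (simp add: spectral_def l_def)
  have l0: "l 0 = 1" using lam1 by (simp add: l_def)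
  have mono: "lam j \<le> lam i" if "2 \<le> i" "i \<le> j" "j \<le> D" for i j
    using that(2,3)
  proof (induction j rule: dec_induct)
    case (step m)
    then have "lam (m + 1) \<le> lam m" using lam_mono that(1) by auto
    then show ?case using step by simp
  qed simp
  have lam_range: "\<tau> \<le> lam j" "lam j \<le> \<beta>" "0 < lam j" "lam j < 1" if "j \<in> {2..D}" for j
    using mono[of j D] mono[of 2 j] that lamD lam2 by (auto simp: \<tau>_def \<beta>_def)
  have \<beta>: "0 < \<beta>" "\<beta> < 1" and \<tau>: "0 < \<tau>" "\<tau> < 1" "\<tau> \<le> \<beta>"
    using lam_range[of 2] lam_range[of D] D2 by (auto simp: \<tau>_def \<beta>_def)
  define mn where "mn = min (\<beta> * ln (1 / \<beta>)) (\<tau> * ln (1 / \<tau>))"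
  have h: "h = 1 / mn" by (simp add: h_def mn_def \<beta>_def \<tau>_def)
  have mn0: "0 < mn" using \<beta> \<tau> by (simp add: mn_def)
  have h0: "0 < h" using mn0 by (simp add: h)
  have hx: "1 / x \<le> h * ln (1 / x)" if "\<tau> \<le> x" "x \<le> \<beta>" for x
  proof -
    have "mn \<le> x * ln (1 / x)" unfolding mn_def using min_entropy_le \<tau> that by auto
    then have "1 \<le> h * (x * ln (1 / x))" using mn0 by (simp add: h pos_le_divide_eq)
    then show ?thesis using \<tau> that by (simp add: pos_divide_le_eq mult.commute mult.left_commute)
  qed
  define b where "b = ln (1 / \<beta>)"
  have b: "0 < b" using \<beta> by (simp add: b_def)
  have h\<beta>: "1 \<le> h * (\<beta> * ln (1 / \<beta>))"
    using hx[of \<beta>] \<tau> \<beta> by (simp add: pos_divide_le_eq mult.commute mult.left_commute)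
  define M where "M = h * F / (1 - F) + 1 / b"
  have M: "M = h * F / (1 - F) + 1 / ln (1 / \<beta>)" by (simp add: M_def b_def)
  \<comment> \<open>Since \<open>1 / b \<le> h * \<beta> \<le> h\<close>, the two summands of
    \<open>M\<close> merge into \<open>h * F / \<epsilon> + h = h / \<epsilon>\<close>; this gives
    the strict right-hand bounds.\<close>
  have Mh: "M \<le> h / \<epsilon>"
  proof -
    have "1 \<le> h * b * \<beta>" using h\<beta> by (simp add: b_def mult.commute mult.left_commute)
    also have "\<dots> \<le> h * b * 1" using h0 b \<beta> by (intro mult_left_mono) auto
    finally have "1 / b \<le> h" using b by (simp add: pos_divide_le_eq)
    then have "M \<le> h * F / (1 - F) + h" by (simp add: M_def)
    also have "\<dots> = h / \<epsilon>" using F unfolding eF[symmetric] by (simp add: field_simps)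
    finally show ?thesis .
  qed
  have expr: "h * F * ln (1 / y) / \<epsilon> + ln y / ln \<beta> - 1 = M * ln (1 / y) - 1" if "0 < y" for y
  proof -
    have "ln y / ln \<beta> = ln (1 / y) / b" using that \<beta> by (simp add: b_def ln_div)
    then show ?thesis by (simp add: M_def eF algebra_simps)
  qed
  have strict: "real_of_int \<lceil>M * ln (1 / y) - 1\<rceil> < h * ln (1 / y) / \<epsilon>" if "0 < y" "y < 1" for y
  proof -
    have "real_of_int \<lceil>M * ln (1 / y) - 1\<rceil> < M * ln (1 / y)" by linarith
    also have "\<dots> \<le> h / \<epsilon> * ln (1 / y)" using Mh that by (intro mult_right_mono) auto
    finally show ?thesis by simp
  qed
  have lr: "0 < l a \<and> l a \<le> \<beta> \<and> 1 / l a \<le> h * ln (1 / l a)" and l\<tau>: "\<tau> \<le> l a"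
    if "0 < a" "a < D" for a
    using lam_range[of "Suc a"] hx[of "l a"] that by (auto simp: l_def)
  have lnn: "0 \<le> l a" if "a < D" for a
    using lr[of a] l0 that by (cases "a = 0") auto

  \<comment> \<open>Upper bounds on the number of tests\<close>
  have Fmin_iff: "x \<le> Fmin D \<Psi> N \<delta> Om \<longleftrightarrow>
      (\<forall>q. symdist D (N + 1) q \<and> \<delta> \<le> pass_prob D N l q \<longrightarrow> x * pass_prob D N l q \<le> pass_fid D N l q)" for x N
    by (rule Fmin_ge_iff[OF spectral lnn l0 del(1) less_imp_le[OF del(2)]])
  have "F * \<delta> < F" using F del by simp
  with F del have y1: "0 < F * \<delta>" "F * \<delta> < 1" by (simp, linarith)
  have "\<tau> * \<delta> < \<tau>" using \<tau> del by simp
  with \<tau> del have y2: "0 < \<tau> * \<delta>" "\<tau> * \<delta> < 1" by (simp, linarith)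
  define ok where "ok A N \<longleftrightarrow> 1 \<le> N \<and> 1 - \<epsilon> \<le> Fmin D \<Psi> N \<delta> A" for A and N :: nat
  have Nver: "Nver D \<Psi> \<epsilon> \<delta> A = (LEAST N. ok A N)" for A by (simp add: Nver_def ok_def)
  \<comment> \<open>Rounding up \<open>M * ln (1 / y) - 1\<close> gives
    \<open>N + 1 \<ge> M * ln (1 / y)\<close>. The premise \<open>gt\<close> makes this integer at
    least 1, so \<open>nat\<close> preserves it and the candidate is admissible.\<close>
  have ok_nat: "ok Om (nat \<lceil>M * ln (1 / y) - 1\<rceil>) \<and> 1 \<le> \<lceil>M * ln (1 / y) - 1\<rceil>"
    if gt: "1 < M * ln (1 / y)"
      and bound: "\<And>N q. M * ln (1 / y) \<le> real (N + 1) \<Longrightarrow> symdist D (N + 1) q \<Longrightarrow> \<delta> \<le> pass_prob D N l q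
        \<Longrightarrow> F * pass_prob D N l q \<le> pass_fid D N l q" for y
  proof -
    have ceil: "1 \<le> \<lceil>M * ln (1 / y) - 1\<rceil>" using gt by linarith
    define N where "N = nat \<lceil>M * ln (1 / y) - 1\<rceil>"
    have "1 \<le> N" unfolding N_def using ceil by linarith
    have "M * ln (1 / y) \<le> real (N + 1)" using ceil unfolding N_def by linarith
    then have "F \<le> Fmin D \<Psi> N \<delta> Om" unfolding Fmin_iff using bound by blast
    then have "ok Om N" using \<open>1 \<le> N\<close> by (simp add: ok_def F_def)
    then show ?thesis using ceil unfolding N_def by blast
  qed
  have ok1: "ok Om (nat \<lceil>M * ln (1 / (F * \<delta>)) - 1\<rceil>) \<and> 1 \<le> \<lceil>M * ln (1 / (F * \<delta>)) - 1\<rceil>"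
  proof (rule ok_nat)
    show "1 < M * ln (1 / (F * \<delta>))"
      unfolding M by (rule fidelity_test_count_gt_1[OF \<beta> F del h\<beta>])
    show "F * pass_prob D N l q \<le> pass_fid D N l q"
      if "M * ln (1 / (F * \<delta>)) \<le> real (N + 1)" "symdist D (N + 1) q" "\<delta> \<le> pass_prob D N l q" for N q
      by (rule fidelity_bound_F[where l = l, OF that(2) l0 lr \<beta> F less_imp_le[OF h0] del M that(1,3)])
  qed
  have ok2: "ok Om (nat \<lceil>M * ln (1 / (\<tau> * \<delta>)) - 1\<rceil>) \<and> 1 \<le> \<lceil>M * ln (1 / (\<tau> * \<delta>)) - 1\<rceil>"
  proof (rule ok_nat)
    \<comment> \<open>Here the summand \<open>1 / b\<close> of \<open>M\<close> suffices, because
      \<open>\<tau> * \<delta> < \<tau> \<le> \<beta>\<close>.\<close>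
    have "b \<le> ln (1 / \<tau>)" unfolding b_def using \<tau> \<beta> by (simp add: frac_le)
    also have "\<dots> < ln (1 / (\<tau> * \<delta>))" using \<tau> del by (simp add: ln_div ln_mult)
    finally have "1 < 1 / b * ln (1 / (\<tau> * \<delta>))" using b by simp
    moreover have "0 \<le> h * F / (1 - F) * ln (1 / (\<tau> * \<delta>))" using h0 F y2 by (intro mult_nonneg_nonneg) auto
    ultimately show "1 < M * ln (1 / (\<tau> * \<delta>))" unfolding M_def distrib_right by linarith
    show "F * pass_prob D N l q \<le> pass_fid D N l q"
      if "M * ln (1 / (\<tau> * \<delta>)) \<le> real (N + 1)" "symdist D (N + 1) q" "\<delta> \<le> pass_prob D N l q" for N q
      by (rule fidelity_bound_tau[where l = l, OF that(2) l0 lr \<tau>(1) less_imp_le[OF \<tau>(2)] l\<tau> \<beta> F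
            less_imp_le[OF h0] del M that(1,3)])
  qed
  have ub: "int NN \<le> \<lceil>M * ln (1 / y) - 1\<rceil>"
    if "ok Om (nat \<lceil>M * ln (1 / y) - 1\<rceil>) \<and> 1 \<le> \<lceil>M * ln (1 / y) - 1\<rceil>" for y
  proof -
    have "NN \<le> nat \<lceil>M * ln (1 / y) - 1\<rceil>" unfolding NN_def Nver using that by (intro Least_le) auto
    then show ?thesis using that by linarith
  qed
  \<comment> \<open>\<open>LEAST\<close> has its defining property only once a witness exists; the
    first upper bound supplies one.\<close>
  have okNN: "ok Om NN" unfolding NN_def Nver using ok1 by (intro LeastI) auto

  \<comment> \<open>Lower bounds through homogeneous operators\<close>
  have lower: "Nver D \<Psi> \<epsilon> \<delta> (hom_op D \<Psi> (lam j)) \<le> NN \<and>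
      kminus \<delta> (lam j) + \<lceil>real_of_int (kminus \<delta> (lam j)) * F / (lam j * \<epsilon>)\<rceil>
        \<le> int (Nver D \<Psi> \<epsilon> \<delta> (hom_op D \<Psi> (lam j)))" if j: "j \<in> {2..D}" for j
  proof -
    let ?A = "hom_op D \<Psi> (lam j)"
    let ?l = "\<lambda>a::nat. if a = 0 then 1 else l (j - 1)"
    have lj: "l (j - 1) = lam j" using j by (simp add: l_def)
    have sp: "spectral ?A ?l" unfolding lj by (rule spectral_hom_op)
    have lnn': "0 \<le> ?l a" for a using lam_range(3)[OF j] unfolding lj by simp
    have "1 - \<epsilon> \<le> Fmin D \<Psi> NN \<delta> Om" using okNN by (simp add: ok_def)
    then have cond: "\<And>q. symdist D (NN + 1) q \<Longrightarrow> \<delta> \<le> pass_prob D NN l q \<Longrightarrow> (1 - \<epsilon>) * pass_prob D NN l q \<le> pass_fid D NN l q"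
      unfolding Fmin_iff by blast
    have "0 < j - 1" "j - 1 < D" using j by auto
    \<comment> \<open>Collapsing transfers the condition to the homogeneous operator with the same
      \<open>NN\<close>. This gives the comparison and also the witness needed for the second
      \<open>LEAST\<close>.\<close>
    from condition_hom_if_condition[where l = l, OF l0 this cond]
    have "1 - \<epsilon> \<le> Fmin D \<Psi> NN \<delta> ?A"
      using Fmin_ge_iff[OF sp lnn' _ del(1) less_imp_le[OF del(2)]] by simp
    then have ok: "ok ?A NN" using okNN by (simp add: ok_def)
    then have le: "Nver D \<Psi> \<epsilon> \<delta> ?A \<le> NN" unfolding Nver by (rule Least_le)
    have "ok ?A (Nver D \<Psi> \<epsilon> \<delta> ?A)" unfolding Nver using ok by (rule LeastI)
    then have "1 - \<epsilon> \<le> Fmin D \<Psi> (Nver D \<Psi> \<epsilon> \<delta> ?A) \<delta> ?A" by (simp add: ok_def)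
    from Nver_hom_op_ge[OF eps del lam_range(3,4)[OF j] this] le show ?thesis by (simp add: F_def)
  qed
  \<comment> \<open>The bound with \<open>\<beta>t\<close> is the case \<open>j = 2\<close> or
    \<open>j = D\<close>.\<close>
  have "\<exists>j\<in>{2..D}. \<beta>t = lam j" using D2 by (auto simp: \<beta>t_def)
  then have "kminus \<delta> \<beta>t + \<lceil>real_of_int (kminus \<delta> \<beta>t) * F / (\<beta>t * \<epsilon>)\<rceil> \<le> int NN"
    using lower by force
  with lower ub[OF ok1] ub[OF ok2] strict[OF y1] strict[OF y2] show ?thesis
    unfolding expr[OF y1(1)] expr[OF y2(1)] by blast
qed

end
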